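(* Let $\Gamma_{\circlearrowright}$ denote either of the two versions $\mathcal A$, $\mathcal B$ of the wheeled graphical category. Then $\Gamma_{\circlearrowright}$ does not admit the structure of an EZ-category (that is, there is no degree function $\mathrm{Ob}(\Gamma_{\circlearrowright})\to\mathbb N$ making it an EZ-category).
   Context: **Graphs.** A graph here is a connected directed graph $G$, possibly with directed cycles, of one of three kinds: the exceptional edge $\uparrow$ (no vertices, one edge $e$, with $\mathrm{in}(\uparrow)=\mathrm{out}(\uparrow)=\{e\}$ and no inner edges); the exceptional loop $\circlearrowright$ (no vertices, one edge, which is an inner edge; no inputs or outputs); or an ordinary graph, consisting of a finite nonempty set $\mathrm{Vt}(G)$, a finite set $\mathrm{Edge}(G)$ and partial functions $\mathrm{src},\mathrm{tgt}\colon\mathrm{Edge}(G)\to\mathrm{Vt}(G)$, at least one of them defined on each edge, with connected result. Put $\mathrm{in}(v)=\mathrm{tgt}^{-1}(v)$, $\mathrm{out}(v)=\mathrm{src}^{-1}(v)$. For an ordinary graph, $\mathrm{in}(G)$ (resp. $\mathrm{out}(G)$) is the set of edges with $\mathrm{src}$ (resp. $\mathrm{tgt}$) undefined, and inner edges are those with both defined. Graphs are drawn from a fixed set containing every isomorphism type, so categories below are small; orderings of legs are suppressed. **Substitution.** Given graphs $P_v$ with bijections $\mathrm{in}(v)\cong\mathrm{in}(P_v)$, $\mathrm{out}(v)\cong\mathrm{out}(P_v)$ for $v\in\mathrm{Vt}(G)$, the graph $G(\{P_v\})$ is obtained by replacing each $v$ by $P_v$ and identifying legs accordingly. (Substituting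 $\uparrow$ for $v$ deletes $v$ and merges its input and output edge; if the result has no vertices it is $\uparrow$ or $\circlearrowright$, according to whether it has legs or not.) **Subgraphs.** The subgraphs of $K$ are: (a) for each $e\in\mathrm{Edge}(K)$, the edge $\uparrow_e$; (b) if $K=\circlearrowright$, $K$ itself; (c) for each nonempty $S\subseteq\mathrm{Vt}(K)$ and each set $I$ of inner edges of $K$ with both ends in $S$ such that the graph $(S,I)$ is connected, the graph $K_{S,I}$ with vertex set $S$, inner edges $I$, one input leg for each edge $e\notin I$ with $\mathrm{tgt}(e)\in S$ and one output leg for each edge $e\notin I$ with $\mathrm{src}(e)\in S$ (an edge $e\notin I$ with both ends in $S$ gives two distinct legs). Each subgraph has canonical maps on edges and vertices to $K$, injective on its set of inputs and on its set of outputs. **The wheeled graphical category.** $\mathcal A$ has all graphs as objects. A morphism $f\colon G\to K$ (a wheeled properadic graphical map) is a map between the free wheeled properads generated by $G$ and $K$ whose image is a subgraph; explicitly, it consists of a function $f_0\colon\mathrm{Edge}(G)\to\mathrm{Edge}(K)$ and a function $f_1$ from $\mathrm{Vt}(G)$ to subgraphs of $K$ such that for each $v$, $f_0$ restricts to bijections $\mathrm{in}(v)\to\mathrm{in}(f_1(v))$ and $\mathrm{out}(v)\to\mathrm{out}(f_1(v))$ (inputs and outputs of $f_1(v)$ being regarded as edges of $K$), and such that the graph $f(G)=G(\{f_1(v)\})$, with its canonical maps on edges and vertices to $K$, is (isomorphic over $K$ to) a subgraph of $K$. Composition: $(gf)_0=g_0f_0$ and $(gf)_1(v)$ is the image $g(f_1(v))$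 of the composite of $g$ with $f_1(v)\to K$. $\mathcal B$ is the full subcategory of $\mathcal A$ on all graphs other than $\circlearrowright$. **EZ-category (Berger–Moerdijk).** A small category $\mathcal R$ equipped with a degree function $\mathrm{Ob}(\mathcal R)\to\mathbb N$ such that (1) monomorphisms preserve (resp. raise) the degree if and only if they are invertible (resp. non-invertible); (2) every morphism factors as a split epimorphism followed by a monomorphism; (3) any pair of split epimorphisms with common domain has a strong pushout, i.e. they fit in a commutative square whose image under the Yoneda embedding $\mathcal R\to \mathrm{Set}^{\mathcal R^{op}}$ is a pushout. *)

theory Defs
  imports "HOL-Library.FuncSet"
begin

section \<open>Graphs\<close>

text \<open>
  In an ordinary graph the partial functions are maps whose domains lie in the edge set.
  The two exceptional graphs record the name of their only edge, on which neither
  \<open>src\<close> nor \<open>tgt\<close> is defined.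
\<close>

datatype ('v, 'e) graph =
    is_Exc_Edge: Exc_Edge 'e
  | is_Exc_Loop: Exc_Loop 'e
  | is_Ordinary: Ordinary "'v set" "'e set" "'e \<rightharpoonup> 'v" "'e \<rightharpoonup> 'v"

fun verts :: "('v, 'e) graph \<Rightarrow> 'v set" where
  "verts (Exc_Edge e) = {}"
| "verts (Exc_Loop e) = {}"
| "verts (Ordinary V E s t) = V"

fun edges :: "('v, 'e) graph \<Rightarrow> 'e set" where
  "edges (Exc_Edge e) = {e}"
| "edges (Exc_Loop e) = {e}"
| "edges (Ordinary V E s t) = E"

fun src :: "('v, 'e) graph \<Rightarrow> 'e \<rightharpoonup> 'v" where
  "src (Exc_Edge e) = Map.empty"
| "src (Exc_Loop e) = Map.empty"
| "src (Ordinary V E s t) = s"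

fun tgt :: "('v, 'e) graph \<Rightarrow> 'e \<rightharpoonup> 'v" where
  "tgt (Exc_Edge e) = Map.empty"
| "tgt (Exc_Loop e) = Map.empty"
| "tgt (Ordinary V E s t) = t"

fun ins :: "('v, 'e) graph \<Rightarrow> 'e set" where
  "ins (Exc_Edge e) = {e}"
| "ins (Exc_Loop e) = {}"
| "ins (Ordinary V E s t) = {e \<in> E. s e = None}"

fun outs :: "('v, 'e) graph \<Rightarrow> 'e set" where
  "outs (Exc_Edge e) = {e}"
| "outs (Exc_Loop e) = {}"
| "outs (Ordinary V E s t) = {e \<in> E. t e = None}"

definition ins_at :: "('v, 'e) graph \<Rightarrow> 'v \<Rightarrow> 'e set" where
  "ins_at G v = {e \<in> edges G. tgt G e = Some v}"

definition outs_at :: "('v, 'e) graph \<Rightarrow> 'v \<Rightarrow> 'e set" where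
  "outs_at G v = {e \<in> edges G. src G e = Some v}"

definition connected_by :: "('v, 'e) graph \<Rightarrow> 'v set \<Rightarrow> 'e set \<Rightarrow> bool" where
  "connected_by G S I \<longleftrightarrow>
     (let R = {(u, v). \<exists>e\<in>I. src G e = Some u \<and> tgt G e = Some v}
      in \<forall>u\<in>S. \<forall>v\<in>S. (u, v) \<in> (R \<union> R\<inverse>)\<^sup>*)"

fun wf_graph :: "('v, 'e) graph \<Rightarrow> bool" where
  "wf_graph (Exc_Edge e) \<longleftrightarrow> True"
| "wf_graph (Exc_Loop e) \<longleftrightarrow> True"
| "wf_graph (Ordinary V E s t) \<longleftrightarrow>
     finite V \<and> V \<noteq> {} \<and> finite E \<and> dom s \<union> dom t = E \<and> ran s \<subseteq> V \<and> ran t \<subseteq> V \<and>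
     connected_by (Ordinary V E s t) V (dom s \<inter> dom t)"

definition graph_iso ::
  "('v, 'e) graph \<Rightarrow> ('w, 'd) graph \<Rightarrow> ('v \<Rightarrow> 'w) \<Rightarrow> ('e \<Rightarrow> 'd) \<Rightarrow> bool" where
  "graph_iso G H \<phi> \<psi> \<longleftrightarrow>
     is_Exc_Edge G = is_Exc_Edge H \<and> is_Exc_Loop G = is_Exc_Loop H \<and>
     bij_betw \<phi> (verts G) (verts H) \<and> bij_betw \<psi> (edges G) (edges H) \<and>
     (\<forall>e\<in>edges G. src H (\<psi> e) = map_option \<phi> (src G e) \<and> tgt H (\<psi> e) = map_option \<phi> (tgt G e))"

text \<open>
  \<open>G\<close> and \<open>H\<close> are isomorphic over a third graph, to which they are mapped by \<open>p, q\<close> and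
  \<open>p', q'\<close> (on vertices and on edges).
\<close>

definition isomorphic_over ::
  "('v, 'e) graph \<Rightarrow> ('v \<Rightarrow> 'x) \<Rightarrow> ('e \<Rightarrow> 'y) \<Rightarrow>
   ('w, 'd) graph \<Rightarrow> ('w \<Rightarrow> 'x) \<Rightarrow> ('d \<Rightarrow> 'y) \<Rightarrow> bool" where
  "isomorphic_over G p q H p' q' \<longleftrightarrow>
     (\<exists>\<phi> \<psi>. graph_iso G H \<phi> \<psi> \<and>
            (\<forall>v\<in>verts G. p' (\<phi> v) = p v) \<and> (\<forall>e\<in>edges G. q' (\<psi> e) = q e))"


section \<open>Graph substitution\<close>

text \<open>
  Substitution of \<open>P v\<close> for each vertex \<open>v\<close> of \<open>G\<close>, along bijections
  \<open>\<alpha> v : in(v) \<rightarrow> in(P v)\<close> and \<open>\<beta> v : out(v) \<rightarrow> out(P v)\<close>. The edges of the result are the classes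
  of the equivalence relation on the disjoint union of \<open>edges G\<close> and all \<open>edges (P v)\<close>
  generated by identifying \<open>e\<close> with \<open>\<alpha> v e\<close> and \<open>\<beta> v e\<close>.
\<close>

definition glue ::
  "('v, 'e) graph \<Rightarrow> ('v \<Rightarrow> 'e \<Rightarrow> 'd) \<Rightarrow> ('v \<Rightarrow> 'e \<Rightarrow> 'd) \<Rightarrow> ('e + 'v \<times> 'd) rel" where
  "glue G \<alpha> \<beta> =
     {(Inl e, Inr (v, \<alpha> v e)) | v e. v \<in> verts G \<and> e \<in> ins_at G v} \<union>
     {(Inl e, Inr (v, \<beta> v e)) | v e. v \<in> verts G \<and> e \<in> outs_at G v}"

definition subst_edges ::
  "('v, 'e) graph \<Rightarrow> ('v \<Rightarrow> ('w, 'd) graph) \<Rightarrow> ('v \<Rightarrow> 'e \<Rightarrow> 'd) \<Rightarrow> ('v \<Rightarrow> 'e \<Rightarrow> 'd) \<Rightarrow>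
   ('e + 'v \<times> 'd) set set" where
  "subst_edges G P \<alpha> \<beta> =
     (Inl ` edges G \<union> Inr ` (SIGMA v : verts G. edges (P v))) //
     ((glue G \<alpha> \<beta> \<union> (glue G \<alpha> \<beta>)\<inverse>)\<^sup>*)"

text \<open>
  The end (\<open>en = src\<close> or \<open>en = tgt\<close>) of an edge class is the end of any of its members lying in
  some \<open>P v\<close> for which it is defined; there is at most one such end.
\<close>

definition subst_end ::
  "(('w, 'd) graph \<Rightarrow> 'd \<rightharpoonup> 'w) \<Rightarrow> ('v, 'e) graph \<Rightarrow> ('v \<Rightarrow> ('w, 'd) graph) \<Rightarrow>
   ('e + 'v \<times> 'd) set \<rightharpoonup> 'v \<times> 'w" where
  "subst_end en G P c =
     (let ends = {(v, w). v \<in> verts G \<and> (\<exists>d. Inr (v, d) \<in> c \<and> en (P v) d = Some w)}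
      in if ends = {} then None else Some (THE x. x \<in> ends))"

text \<open>
  The legs of the result correspond to those of \<open>G\<close>; if the result has no vertices, then it has
  exactly one edge.
\<close>

definition subst ::
  "('v, 'e) graph \<Rightarrow> ('v \<Rightarrow> ('w, 'd) graph) \<Rightarrow> ('v \<Rightarrow> 'e \<Rightarrow> 'd) \<Rightarrow> ('v \<Rightarrow> 'e \<Rightarrow> 'd) \<Rightarrow>
   ('v \<times> 'w, ('e + 'v \<times> 'd) set) graph" where
  "subst G P \<alpha> \<beta> =
     (let V = (SIGMA v : verts G. verts (P v)); E = subst_edges G P \<alpha> \<beta>
      in if V = {}
         then (if ins G \<union> outs G \<noteq> {} then Exc_Edge (the_elem E) else Exc_Loop (the_elem E))
         else Ordinary V E (subst_end src G P |` E) (subst_end tgt G P |` E))"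


section \<open>Subgraphs\<close>

datatype ('v, 'e) subgraph =
    Sub_Edge 'e
  | Sub_Loop
  | Sub_Verts "'v set" "'e set"

definition subgraphs :: "('v, 'e) graph \<Rightarrow> ('v, 'e) subgraph set" where
  "subgraphs K =
     Sub_Edge ` edges K \<union>
     (if is_Exc_Loop K then {Sub_Loop} else {}) \<union>
     {Sub_Verts S I | S I. S \<noteq> {} \<and> S \<subseteq> verts K \<and>
        I \<subseteq> {e \<in> edges K. \<exists>u\<in>S. \<exists>v\<in>S. src K e = Some u \<and> tgt K e = Some v} \<and>
        connected_by K S I}"

text \<open>
  Edges of a subgraph. An edge \<open>e \<notin> I\<close> of \<open>K\<close> with both ends in \<open>S\<close> is cut into the two legs
  \<open>In_Leg e\<close> and \<open>Out_Leg e\<close>; \<open>base\<close> is the canonical map to the edges of \<open>K\<close>. The canonical map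
  on vertices is the inclusion.
\<close>

datatype 'e sub_edge = Full (base: 'e) | In_Leg (base: 'e) | Out_Leg (base: 'e)

fun graph_of :: "('v, 'e) graph \<Rightarrow> ('v, 'e) subgraph \<Rightarrow> ('v, 'e sub_edge) graph" where
  "graph_of K (Sub_Edge e) = Exc_Edge (Full e)"
| "graph_of K Sub_Loop = Exc_Loop (Full (the_elem (edges K)))"
| "graph_of K (Sub_Verts S I) =
     (let A = {e \<in> edges K - I. tgt K e \<in> Some ` S}; B = {e \<in> edges K - I. src K e \<in> Some ` S}
      in Ordinary S (Full ` I \<union> In_Leg ` A \<union> Out_Leg ` B)
           (\<lambda>d. case d of Full e \<Rightarrow> (src K |` I) e | In_Leg e \<Rightarrow> None | Out_Leg e \<Rightarrow> (src K |` B) e)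
           (\<lambda>d. case d of Full e \<Rightarrow> (tgt K |` I) e | In_Leg e \<Rightarrow> (tgt K |` A) e | Out_Leg e \<Rightarrow> None))"


section \<open>Wheeled properadic graphical maps\<close>

text \<open>
  The graph \<open>f(G) = G({f\<^sub>1(v)})\<close> and its canonical maps to \<open>K\<close>. The canonical map on vertices
  is \<open>snd\<close>; the one on edges is constant on each edge class.
\<close>

definition image_graph ::
  "('v, 'e) graph \<Rightarrow> ('w, 'd) graph \<Rightarrow> ('e \<Rightarrow> 'd) \<Rightarrow> ('v \<Rightarrow> ('w, 'd) subgraph) \<Rightarrow>
   ('v \<times> 'w, ('e + 'v \<times> 'd sub_edge) set) graph" where
  "image_graph G K f\<^sub>0 f\<^sub>1 =
     (let P = (\<lambda>v. graph_of K (f\<^sub>1 v))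
      in subst G P (\<lambda>v e. the_inv_into (ins (P v)) base (f\<^sub>0 e))
                   (\<lambda>v e. the_inv_into (outs (P v)) base (f\<^sub>0 e)))"

definition image_edge_map :: "('e \<Rightarrow> 'd) \<Rightarrow> ('e + 'v \<times> 'd sub_edge) set \<Rightarrow> 'd" where
  "image_edge_map f\<^sub>0 c = the_elem (case_sum f\<^sub>0 (\<lambda>(v, d). base d) ` c)"

definition has_image ::
  "('v, 'e) graph \<Rightarrow> ('w, 'd) graph \<Rightarrow> ('e \<Rightarrow> 'd) \<Rightarrow> ('v \<Rightarrow> ('w, 'd) subgraph) \<Rightarrow>
   ('w, 'd) subgraph \<Rightarrow> bool" where
  "has_image G K f\<^sub>0 f\<^sub>1 X \<longleftrightarrow> X \<in> subgraphs K \<and>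
     isomorphic_over (image_graph G K f\<^sub>0 f\<^sub>1) snd (image_edge_map f\<^sub>0)
                     (graph_of K X) (\<lambda>w. w) base"

definition graphical_map ::
  "('v, 'e) graph \<Rightarrow> ('w, 'd) graph \<Rightarrow> ('e \<Rightarrow> 'd) \<Rightarrow> ('v \<Rightarrow> ('w, 'd) subgraph) \<Rightarrow> bool" where
  "graphical_map G K f\<^sub>0 f\<^sub>1 \<longleftrightarrow>
     f\<^sub>0 \<in> edges G \<rightarrow> edges K \<and> f\<^sub>1 \<in> verts G \<rightarrow> subgraphs K \<and>
     (\<forall>v\<in>verts G.
        bij_betw f\<^sub>0 (ins_at G v) (base ` ins (graph_of K (f\<^sub>1 v))) \<and>
        bij_betw f\<^sub>0 (outs_at G v) (base ` outs (graph_of K (f\<^sub>1 v)))) \<and>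
     (\<exists>X. has_image G K f\<^sub>0 f\<^sub>1 X)"


section \<open>Categories\<close>

record ('o, 'm) category =
  Obj :: "'o set"
  Arr :: "'m set"
  Dom :: "'m \<Rightarrow> 'o"
  Cod :: "'m \<Rightarrow> 'o"
  Idn :: "'o \<Rightarrow> 'm"
  Cmp :: "'m \<Rightarrow> 'm \<Rightarrow> 'm"

definition hom :: "('o, 'm) category \<Rightarrow> 'o \<Rightarrow> 'o \<Rightarrow> 'm set" where
  "hom C a b = {f \<in> Arr C. Dom C f = a \<and> Cod C f = b}"

definition category_axioms :: "('o, 'm) category \<Rightarrow> bool" where
  "category_axioms C \<longleftrightarrow>
     (\<forall>f\<in>Arr C. Dom C f \<in> Obj C \<and> Cod C f \<in> Obj C) \<and>
     (\<forall>a\<in>Obj C. Idn C a \<in> hom C a a) \<and>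
     (\<forall>a b c. \<forall>f\<in>hom C a b. \<forall>g\<in>hom C b c. Cmp C g f \<in> hom C a c) \<and>
     (\<forall>a b. \<forall>f\<in>hom C a b. Cmp C f (Idn C a) = f \<and> Cmp C (Idn C b) f = f) \<and>
     (\<forall>a b c d. \<forall>f\<in>hom C a b. \<forall>g\<in>hom C b c. \<forall>h\<in>hom C c d.
        Cmp C h (Cmp C g f) = Cmp C (Cmp C h g) f)"

definition full_subcategory :: "('o, 'm) category \<Rightarrow> 'o set \<Rightarrow> ('o, 'm) category" where
  "full_subcategory C U =
     C\<lparr>Obj := Obj C \<inter> U, Arr := {f \<in> Arr C. Dom C f \<in> U \<and> Cod C f \<in> U}\<rparr>"

definition mono_arr :: "('o, 'm) category \<Rightarrow> 'm \<Rightarrow> bool" where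
  "mono_arr C m \<longleftrightarrow> m \<in> Arr C \<and>
     (\<forall>c. \<forall>g\<in>hom C c (Dom C m). \<forall>h\<in>hom C c (Dom C m). Cmp C m g = Cmp C m h \<longrightarrow> g = h)"

definition split_epi :: "('o, 'm) category \<Rightarrow> 'm \<Rightarrow> bool" where
  "split_epi C e \<longleftrightarrow> e \<in> Arr C \<and>
     (\<exists>s\<in>hom C (Cod C e) (Dom C e). Cmp C e s = Idn C (Cod C e))"

definition invertible_arr :: "('o, 'm) category \<Rightarrow> 'm \<Rightarrow> bool" where
  "invertible_arr C f \<longleftrightarrow> f \<in> Arr C \<and>
     (\<exists>g\<in>hom C (Cod C f) (Dom C f).
        Cmp C g f = Idn C (Dom C f) \<and> Cmp C f g = Idn C (Cod C f))"


section \<open>Presheaves and strong pushouts\<close>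

record ('o, 'm, 'u) presheaf_data =
  sec :: "'o \<Rightarrow> 'u set"
  act :: "'m \<Rightarrow> 'u \<Rightarrow> 'u"

definition presheaf :: "('o, 'm) category \<Rightarrow> ('o, 'm, 'u) presheaf_data \<Rightarrow> bool" where
  "presheaf C F \<longleftrightarrow>
     (\<forall>a b. \<forall>f\<in>hom C a b. act F f \<in> sec F b \<rightarrow> sec F a) \<and>
     (\<forall>a\<in>Obj C. \<forall>x\<in>sec F a. act F (Idn C a) x = x) \<and>
     (\<forall>a b c. \<forall>f\<in>hom C a b. \<forall>g\<in>hom C b c. \<forall>x\<in>sec F c.
        act F (Cmp C g f) x = act F f (act F g x))"

definition nat_trans ::
  "('o, 'm) category \<Rightarrow> ('o, 'm, 'u) presheaf_data \<Rightarrow> ('o, 'm, 'w) presheaf_data \<Rightarrow>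
   ('o \<Rightarrow> 'u \<Rightarrow> 'w) \<Rightarrow> bool" where
  "nat_trans C F G \<eta> \<longleftrightarrow>
     \<eta> \<in> (\<Pi>\<^sub>E a\<in>Obj C. sec F a \<rightarrow>\<^sub>E sec G a) \<and>
     (\<forall>a b. \<forall>f\<in>hom C a b. \<forall>x\<in>sec F b. \<eta> a (act F f x) = act G f (\<eta> b x))"

definition yoneda :: "('o, 'm) category \<Rightarrow> 'o \<Rightarrow> ('o, 'm, 'm) presheaf_data" where
  "yoneda C a = \<lparr>sec = (\<lambda>r. hom C r a), act = (\<lambda>f x. Cmp C x f)\<rparr>"

definition yoneda_map :: "('o, 'm) category \<Rightarrow> 'm \<Rightarrow> 'o \<Rightarrow> 'm \<Rightarrow> 'm" where
  "yoneda_map C f = (\<lambda>r\<in>Obj C. \<lambda>x\<in>hom C r (Dom C f). Cmp C f x)"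

text \<open>
  The square with sides \<open>\<alpha> : F \<rightarrow> G\<close>, \<open>\<beta> : F \<rightarrow> H\<close>, \<open>\<gamma> : G \<rightarrow> P\<close>, \<open>\<delta> : H \<rightarrow> P\<close> is a pushout of
  presheaves, as tested on presheaves of subsets of the type \<open>'u\<close>.
\<close>

definition presheaf_pushout ::
  "'u itself \<Rightarrow> ('o, 'm) category \<Rightarrow>
   ('o, 'm, 'f) presheaf_data \<Rightarrow> ('o, 'm, 'g) presheaf_data \<Rightarrow>
   ('o, 'm, 'h) presheaf_data \<Rightarrow> ('o, 'm, 'p) presheaf_data \<Rightarrow>
   ('o \<Rightarrow> 'f \<Rightarrow> 'g) \<Rightarrow> ('o \<Rightarrow> 'f \<Rightarrow> 'h) \<Rightarrow> ('o \<Rightarrow> 'g \<Rightarrow> 'p) \<Rightarrow> ('o \<Rightarrow> 'h \<Rightarrow> 'p) \<Rightarrow> bool" where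
  "presheaf_pushout TYPE('u) C F G H P \<alpha> \<beta> \<gamma> \<delta> \<longleftrightarrow>
     (\<forall>a\<in>Obj C. \<forall>x\<in>sec F a. \<gamma> a (\<alpha> a x) = \<delta> a (\<beta> a x)) \<and>
     (\<forall>(X :: ('o, 'm, 'u) presheaf_data) \<xi> \<zeta>.
        presheaf C X \<and> nat_trans C G X \<xi> \<and> nat_trans C H X \<zeta> \<and>
        (\<forall>a\<in>Obj C. \<forall>x\<in>sec F a. \<xi> a (\<alpha> a x) = \<zeta> a (\<beta> a x)) \<longrightarrow>
        (\<exists>!\<eta>. nat_trans C P X \<eta> \<and>
           (\<forall>a\<in>Obj C. \<forall>x\<in>sec G a. \<eta> a (\<gamma> a x) = \<xi> a x) \<and>
           (\<forall>a\<in>Obj C. \<forall>x\<in>sec H a. \<eta> a (\<delta> a x) = \<zeta> a x)))"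

text \<open>
  For the Yoneda image of a commutative square \<open>p f = q g\<close>, the type \<open>('m + 'm) set\<close> is large
  enough for the universal property tested on it to imply the one for presheaves of sets of any
  type; this is proved in \<open>strong_pushout_universal\<close> below.
\<close>

definition strong_pushout :: "('o, 'm) category \<Rightarrow> 'm \<Rightarrow> 'm \<Rightarrow> 'm \<Rightarrow> 'm \<Rightarrow> bool" where
  "strong_pushout C f g p q \<longleftrightarrow>
     f \<in> Arr C \<and> g \<in> Arr C \<and> p \<in> Arr C \<and> q \<in> Arr C \<and>
     Dom C f = Dom C g \<and> Dom C p = Cod C f \<and> Dom C q = Cod C g \<and> Cod C p = Cod C q \<and>
     Cmp C p f = Cmp C q g \<and>
     presheaf_pushout TYPE(('m + 'm) set) C
       (yoneda C (Dom C f)) (yoneda C (Cod C f)) (yoneda C (Cod C g)) (yoneda C (Cod C p))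
       (yoneda_map C f) (yoneda_map C g) (yoneda_map C p) (yoneda_map C q)"

lemma strong_pushout_universal:
  fixes C :: "('o, 'm) category"
  assumes cat: "category_axioms C" and po: "strong_pushout C f g p q"
  shows "presheaf_pushout TYPE('u) C
    (yoneda C (Dom C f)) (yoneda C (Cod C f)) (yoneda C (Cod C g)) (yoneda C (Cod C p))
    (yoneda_map C f) (yoneda_map C g) (yoneda_map C p) (yoneda_map C q)"
proof -
  define a b c d where "a = Dom C f" "b = Cod C f" "c = Cod C g" "d = Cod C p"
  note abcd = this
  have obj: "r \<in> Obj C" "s \<in> Obj C" if "x \<in> hom C r s" for x r s
    using cat that by (auto simp: category_axioms_def hom_def)
  have idn: "Idn C r \<in> hom C r r" if "r \<in> Obj C" for r
    using cat that by (auto simp: category_axioms_def)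
  have cmp: "Cmp C y x \<in> hom C r t" if "x \<in> hom C r s" "y \<in> hom C s t" for x y r s t
    using cat that unfolding category_axioms_def by blast
  have idr: "Cmp C x (Idn C r) = x" if "x \<in> hom C r s" for x r s
    using cat that unfolding category_axioms_def by blast
  have assoc: "Cmp C z (Cmp C y x) = Cmp C (Cmp C z y) x"
    if "x \<in> hom C r s" "y \<in> hom C s t" "z \<in> hom C t u" for x y z r s t u
    using cat that unfolding category_axioms_def by blast
  have f: "f \<in> hom C a b" and g: "g \<in> hom C a c" and p: "p \<in> hom C b d" and q: "q \<in> hom C c d"
    and sq: "Cmp C p f = Cmp C q g"
    and pp: "presheaf_pushout TYPE(('m + 'm) set) C (yoneda C a) (yoneda C b) (yoneda C c)
      (yoneda C d) (yoneda_map C f) (yoneda_map C g) (yoneda_map C p) (yoneda_map C q)"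
    using po by (auto simp: strong_pushout_def hom_def abcd)
  have ym: "yoneda_map C h r x = Cmp C h x" if "h \<in> hom C s t" "x \<in> hom C r s" for h r s t x
    using that obj by (auto simp: yoneda_map_def hom_def)
  have sec: "sec (yoneda C s) r = hom C r s" and act: "act (yoneda C s) h x = Cmp C x h"
    for s r h x by (auto simp: yoneda_def)
  have univ: "\<exists>!\<eta>. nat_trans C (yoneda C d) X \<eta> \<and>
      (\<forall>r\<in>Obj C. \<forall>x\<in>hom C r b. \<eta> r (Cmp C p x) = \<xi> r x) \<and>
      (\<forall>r\<in>Obj C. \<forall>x\<in>hom C r c. \<eta> r (Cmp C q x) = \<zeta> r x)"
    if "presheaf C X" "nat_trans C (yoneda C b) X \<xi>" "nat_trans C (yoneda C c) X \<zeta>"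
      "\<And>r x. x \<in> hom C r a \<Longrightarrow> \<xi> r (Cmp C f x) = \<zeta> r (Cmp C g x)"
    for X :: "('o, 'm, ('m + 'm) set) presheaf_data" and \<xi> \<zeta>
    using pp that unfolding presheaf_pushout_def
    by (simp add: sec ym[OF f] ym[OF g] ym[OF p] ym[OF q] cong: ball_cong)

  \<comment> \<open>Testing on the presheaf of sieves shows that \<open>p\<close> and \<open>q\<close> are jointly surjective.\<close>
  have surj: "(\<exists>x\<in>hom C r b. y = Cmp C p x) \<or> (\<exists>x\<in>hom C r c. y = Cmp C q x)"
    if y: "y \<in> hom C r d" for r y
  proof -
    define top :: "'o \<Rightarrow> ('m + 'm) set" where "top r = {Inl h | h s. h \<in> hom C s r}" for r
    define im where
      "im r = {y. (\<exists>x\<in>hom C r b. y = Cmp C p x) \<or> (\<exists>x\<in>hom C r c. y = Cmp C q x)}" for r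
    define X :: "('o, 'm, ('m + 'm) set) presheaf_data" where
      "X = \<lparr>sec = (\<lambda>r. Pow (top r)),
            act = (\<lambda>h S. {Inl k | k s. k \<in> hom C s (Dom C h) \<and> Inl (Cmp C h k) \<in> S})\<rparr>"
    have sX: "sec X r = Pow (top r)" for r by (simp add: X_def)
    have aX: "act X h S = {Inl k | k s. k \<in> hom C s r \<and> Inl (Cmp C h k) \<in> S}"
      if "h \<in> hom C r t" for h r t S using that by (simp add: X_def hom_def)
    have X: "presheaf C X"
      unfolding presheaf_def
    proof (intro conjI allI ballI)
      fix r s h assume h: "h \<in> hom C r s"
      show "act X h \<in> sec X s \<rightarrow> sec X r"
        unfolding aX[OF h] sX top_def by blast
    next
      fix r x assume r: "r \<in> Obj C" and x: "x \<in> sec X r"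
      have "Cmp C (Idn C r) k = k" if "k \<in> hom C s r" for k s
        using cat that unfolding category_axioms_def by blast
      then show "act X (Idn C r) x = x"
        using x by (fastforce simp: aX[OF idn[OF r]] sX top_def)
    next
      fix r s t h k x assume h: "h \<in> hom C r s" and k: "k \<in> hom C s t" and x: "x \<in> sec X t"
      show "act X (Cmp C k h) x = act X h (act X k x)"
        unfolding aX[OF h] aX[OF k] aX[OF cmp[OF h k]]
        using cmp[OF _ h] assoc[OF _ h k] by fastforce
    qed
    define \<eta>1 :: "'o \<Rightarrow> 'm \<Rightarrow> ('m + 'm) set" where
      "\<eta>1 = (\<lambda>r\<in>Obj C. \<lambda>y\<in>hom C r d. top r)"
    define \<eta>2 :: "'o \<Rightarrow> 'm \<Rightarrow> ('m + 'm) set" where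
      "\<eta>2 = (\<lambda>r\<in>Obj C. \<lambda>y\<in>hom C r d. {Inl h | h s. h \<in> hom C s r \<and> Cmp C y h \<in> im s})"
    have act_top: "act X h (top s) = top r" if h: "h \<in> hom C r s" for h r s
      unfolding aX[OF h] top_def using cmp[OF _ h] by blast
    have const: "nat_trans C (yoneda C t) X (\<lambda>r\<in>Obj C. \<lambda>y\<in>hom C r t. top r)" for t
      unfolding nat_trans_def
      by (auto simp: sec sX act act_top obj cmp)
    have n1: "nat_trans C (yoneda C d) X \<eta>1" unfolding \<eta>1_def by (rule const)
    have n2: "nat_trans C (yoneda C d) X \<eta>2"
      unfolding nat_trans_def
    proof (intro conjI allI ballI)
      show "\<eta>2 \<in> (\<Pi>\<^sub>E r\<in>Obj C. sec (yoneda C d) r \<rightarrow>\<^sub>E sec X r)"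
        unfolding \<eta>2_def sec sX top_def restrict_PiE_iff by blast
    next
      fix r s h x assume h: "h \<in> hom C r s" and x: "x \<in> sec (yoneda C d) s"
      then have x: "x \<in> hom C s d" by (simp add: sec)
      show "\<eta>2 r (act (yoneda C d) h x) = act X h (\<eta>2 s x)"
      proof -
        have "Inl (Cmp C h k) \<in> \<eta>2 s x \<longleftrightarrow> Cmp C (Cmp C x h) k \<in> im t" if k: "k \<in> hom C t r" for k t
          using obj[OF h] x cmp[OF k h] assoc[OF k h x] by (auto simp: \<eta>2_def hom_def)
        moreover have "\<eta>2 r (Cmp C x h) =
            {Inl k | k t. k \<in> hom C t r \<and> Cmp C (Cmp C x h) k \<in> im t}"
          using obj[OF h] cmp[OF h x] by (simp add: \<eta>2_def)
        ultimately show ?thesis unfolding aX[OF h] act by blast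
      qed
    qed
    have imp: "Cmp C (Cmp C p x) h \<in> im s" if "x \<in> hom C r b" "h \<in> hom C s r" for x h r s
      unfolding im_def assoc[OF that(2,1) p, symmetric] using cmp[OF that(2,1)] by blast
    have imq: "Cmp C (Cmp C q x) h \<in> im s" if "x \<in> hom C r c" "h \<in> hom C s r" for x h r s
      unfolding im_def assoc[OF that(2,1) q, symmetric] using cmp[OF that(2,1)] by blast
    have e1: "\<forall>r\<in>Obj C. \<forall>x\<in>hom C r b. \<eta>1 r (Cmp C p x) = top r"
      "\<forall>r\<in>Obj C. \<forall>x\<in>hom C r c. \<eta>1 r (Cmp C q x) = top r"
      using cmp[OF _ p] cmp[OF _ q] by (auto simp: \<eta>1_def)
    have e2: "\<forall>r\<in>Obj C. \<forall>x\<in>hom C r b. \<eta>2 r (Cmp C p x) = top r"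
      "\<forall>r\<in>Obj C. \<forall>x\<in>hom C r c. \<eta>2 r (Cmp C q x) = top r"
      using cmp[OF _ p] cmp[OF _ q] imp imq unfolding \<eta>2_def top_def by simp_all blast+
    have "\<eta>1 = \<eta>2"
      using univ[OF X const const] n1 n2 e1 e2 cmp[OF _ f] cmp[OF _ g] obj
      by (simp cong: ball_cong) blast
    moreover have "Inl (Idn C r) \<in> \<eta>1 r y"
      using y obj[OF y] idn[of r] unfolding \<eta>1_def top_def by simp blast
    ultimately have "Inl (Idn C r) \<in> \<eta>2 r y" by simp
    then have "Cmp C y (Idn C r) \<in> im r"
      using y obj[OF y] idn[of r] by (auto simp: \<eta>2_def hom_def)
    then show ?thesis using idr[OF y] by (simp add: im_def)
  qed

  \<comment> \<open>Testing on the pointwise pushout identifies the relation induced by \<open>p\<close> and \<open>q\<close>.\<close>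
  define E :: "'o \<Rightarrow> ('m + 'm) rel" where
    "E r = {(Inl (Cmp C f x), Inr (Cmp C g x)) | x. x \<in> hom C r a}" for r
  define R where "R r = (E r \<union> (E r)\<inverse>)\<^sup>*" for r
  define U :: "'o \<Rightarrow> ('m + 'm) set" where "U r = Inl ` hom C r b \<union> Inr ` hom C r c" for r
  define pre where "pre h = map_sum (\<lambda>x. Cmp C x h) (\<lambda>x. Cmp C x h)" for h
  have Rsym: "(v, u) \<in> R r" if "(u, v) \<in> R r" for u v r
  proof -
    have "sym ((E r \<union> (E r)\<inverse>)\<^sup>*)" by (intro sym_rtrancl) (auto simp: sym_def)
    then show ?thesis using that by (auto simp: R_def sym_def)
  qed
  have Rtrans: "(u, w) \<in> R r" if "(u, v) \<in> R r" "(v, w) \<in> R r" for u v w r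
    using that by (auto simp: R_def)
  have Rrefl: "(u, u) \<in> R r" for u r by (simp add: R_def)
  have Rcls: "R r `` {u} = R r `` {v} \<longleftrightarrow> (u, v) \<in> R r" for u v r
    using Rrefl Rsym Rtrans by blast
  have Epre: "(pre h u, pre h v) \<in> E r" if uv: "(u, v) \<in> E s" and h: "h \<in> hom C r s"
    for h u v r s
  proof -
    obtain x where x: "x \<in> hom C s a" "u = Inl (Cmp C f x)" "v = Inr (Cmp C g x)"
      using uv by (auto simp: E_def)
    then have "pre h u = Inl (Cmp C f (Cmp C x h))" "pre h v = Inr (Cmp C g (Cmp C x h))"
      using assoc[OF h x(1) f] assoc[OF h x(1) g] by (simp_all add: pre_def)
    then show ?thesis using cmp[OF h x(1)] unfolding E_def by blast
  qed
  have Rpre: "(pre h u, pre h v) \<in> R r" if uv: "(u, v) \<in> R s" and h: "h \<in> hom C r s" for h u v r s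
    using uv unfolding R_def
  proof (induction rule: rtrancl_induct)
    case (step v w)
    then have "(pre h v, pre h w) \<in> E r \<union> (E r)\<inverse>" using Epre[OF _ h] by auto
    with step.IH show ?case by (rule rtrancl_into_rtrancl)
  qed simp
  have RU: "v \<in> U r" if "u \<in> U r" "(u, v) \<in> R r" for u v r
    using that(2,1) unfolding R_def
    by (induction rule: rtrancl_induct) (auto simp: E_def U_def intro: cmp[OF _ f] cmp[OF _ g])
  define Q :: "('o, 'm, ('m + 'm) set) presheaf_data" where
    "Q = \<lparr>sec = (\<lambda>r. U r // R r), act = (\<lambda>h S. R (Dom C h) `` (pre h ` S))\<rparr>"
  have aQ: "act Q h (R s `` {u}) = R r `` {pre h u}" if h: "h \<in> hom C r s" for h r s u
  proof -
    have "Dom C h = r" using h by (simp add: hom_def)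
    moreover have "R r `` (pre h ` (R s `` {u})) = R r `` {pre h u}"
    proof safe
      fix v w assume "(u, v) \<in> R s" "(pre h v, w) \<in> R r"
      then show "(pre h u, w) \<in> R r" using Rpre[OF _ h] Rtrans by blast
    next
      fix w assume "(pre h u, w) \<in> R r"
      moreover have "(u, u) \<in> R s" by (simp add: R_def)
      ultimately show "w \<in> R r `` (pre h ` (R s `` {u}))" by blast
    qed
    ultimately show ?thesis by (simp add: Q_def)
  qed
  have Upre: "pre h u \<in> U r" if "u \<in> U s" "h \<in> hom C r s" for h r s u
    using that cmp[OF that(2)] by (auto simp: U_def pre_def)
  have Q: "presheaf C Q"
    unfolding presheaf_def
  proof (intro conjI allI ballI)
    fix r s h assume h: "h \<in> hom C r s"
    show "act Q h \<in> sec Q s \<rightarrow> sec Q r"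
    proof
      fix x assume "x \<in> sec Q s"
      then obtain u where "u \<in> U s" "x = R s `` {u}" by (auto simp: Q_def quotient_def)
      then show "act Q h x \<in> sec Q r"
        using aQ[OF h] Upre[OF _ h] by (auto simp: Q_def quotient_def)
    qed
  next
    fix r x assume r: "r \<in> Obj C" and "x \<in> sec Q r"
    then obtain u where u: "u \<in> U r" "x = R r `` {u}" by (auto simp: Q_def quotient_def)
    then have "pre (Idn C r) u = u" using idr by (auto simp: U_def pre_def)
    then show "act Q (Idn C r) x = x" using u aQ[OF idn[OF r]] by simp
  next
    fix r s t h k x assume h: "h \<in> hom C r s" and k: "k \<in> hom C s t" and "x \<in> sec Q t"
    then obtain u where u: "u \<in> U t" "x = R t `` {u}" by (auto simp: Q_def quotient_def)
    then have "pre (Cmp C k h) u = pre h (pre k u)"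
      using assoc[OF h k] by (auto simp: U_def pre_def)
    then show "act Q (Cmp C k h) x = act Q h (act Q k x)"
      using u by (simp add: aQ[OF h] aQ[OF k] aQ[OF cmp[OF h k]])
  qed
  define \<iota>1 where "\<iota>1 = (\<lambda>r\<in>Obj C. \<lambda>x\<in>hom C r b. R r `` {Inl x})"
  define \<iota>2 where "\<iota>2 = (\<lambda>r\<in>Obj C. \<lambda>x\<in>hom C r c. R r `` {Inr x})"
  have i1: "nat_trans C (yoneda C b) Q \<iota>1"
    unfolding nat_trans_def
  proof (intro conjI allI ballI)
    show "\<iota>1 \<in> (\<Pi>\<^sub>E r\<in>Obj C. sec (yoneda C b) r \<rightarrow>\<^sub>E sec Q r)"
      by (auto simp: \<iota>1_def sec Q_def U_def quotient_def)
  next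
    fix r s h x assume h: "h \<in> hom C r s" and "x \<in> sec (yoneda C b) s"
    then show "\<iota>1 r (act (yoneda C b) h x) = act Q h (\<iota>1 s x)"
      using obj[OF h] cmp[OF h] by (simp add: \<iota>1_def sec act aQ[OF h] pre_def)
  qed
  have i2: "nat_trans C (yoneda C c) Q \<iota>2"
    unfolding nat_trans_def
  proof (intro conjI allI ballI)
    show "\<iota>2 \<in> (\<Pi>\<^sub>E r\<in>Obj C. sec (yoneda C c) r \<rightarrow>\<^sub>E sec Q r)"
      by (auto simp: \<iota>2_def sec Q_def U_def quotient_def)
  next
    fix r s h x assume h: "h \<in> hom C r s" and "x \<in> sec (yoneda C c) s"
    then show "\<iota>2 r (act (yoneda C c) h x) = act Q h (\<iota>2 s x)"
      using obj[OF h] cmp[OF h] by (simp add: \<iota>2_def sec act aQ[OF h] pre_def)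
  qed
  have "\<iota>1 r (Cmp C f x) = \<iota>2 r (Cmp C g x)" if x: "x \<in> hom C r a" for r x
  proof -
    have "(Inl (Cmp C f x), Inr (Cmp C g x)) \<in> R r" using x by (auto simp: R_def E_def)
    then show ?thesis
      using obj[OF x] cmp[OF x f] cmp[OF x g] by (simp add: \<iota>1_def \<iota>2_def Rcls)
  qed
  from univ[OF Q i1 i2 this] obtain \<theta> where \<theta>:
    "\<forall>r\<in>Obj C. \<forall>x\<in>hom C r b. \<theta> r (Cmp C p x) = \<iota>1 r x"
    "\<forall>r\<in>Obj C. \<forall>x\<in>hom C r c. \<theta> r (Cmp C q x) = \<iota>2 r x"
    by blast
  have t1: "\<theta> r (Cmp C p x) = R r `` {Inl x}" if x: "x \<in> hom C r b" for r x
    using \<theta>(1) x obj[OF x] by (simp add: \<iota>1_def)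
  have t2: "\<theta> r (Cmp C q x) = R r `` {Inr x}" if x: "x \<in> hom C r c" for r x
    using \<theta>(2) x obj[OF x] by (simp add: \<iota>2_def)

  show ?thesis
    unfolding presheaf_pushout_def abcd[symmetric]
  proof (intro conjI allI ballI impI)
    fix r x assume "x \<in> sec (yoneda C a) r"
    then have x: "x \<in> hom C r a" by (simp add: sec)
    show "yoneda_map C p r (yoneda_map C f r x) = yoneda_map C q r (yoneda_map C g r x)"
      using cmp[OF x f] cmp[OF x g] assoc[OF x f p] assoc[OF x g q] sq
      by (simp add: ym[OF f x] ym[OF g x] ym[OF p] ym[OF q])
  next
    fix X :: "('o, 'm, 'u) presheaf_data" and \<xi> \<zeta>
    assume as: "presheaf C X \<and> nat_trans C (yoneda C b) X \<xi> \<and> nat_trans C (yoneda C c) X \<zeta> \<and>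
      (\<forall>r\<in>Obj C. \<forall>x\<in>sec (yoneda C a) r.
         \<xi> r (yoneda_map C f r x) = \<zeta> r (yoneda_map C g r x))"
    have co: "\<xi> r (Cmp C f x) = \<zeta> r (Cmp C g x)" if "x \<in> hom C r a" for r x
    proof -
      have "\<xi> r (yoneda_map C f r x) = \<zeta> r (yoneda_map C g r x)"
        using as that obj[OF that] unfolding sec by blast
      then show ?thesis by (simp add: ym[OF f that] ym[OF g that])
    qed
    have \<xi>: "\<xi> r x \<in> sec X r" if "x \<in> hom C r b" for r x
      using as obj[OF that] that by (auto simp: nat_trans_def sec dest: PiE_mem)
    have \<zeta>: "\<zeta> r x \<in> sec X r" if "x \<in> hom C r c" for r x
      using as obj[OF that] that by (auto simp: nat_trans_def sec dest: PiE_mem)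
    have \<xi>n: "\<xi> r (Cmp C x h) = act X h (\<xi> s x)" if "h \<in> hom C r s" "x \<in> hom C s b" for r s h x
      using as that by (auto simp: nat_trans_def sec act)
    have \<zeta>n: "\<zeta> r (Cmp C x h) = act X h (\<zeta> s x)" if "h \<in> hom C r s" "x \<in> hom C s c" for r s h x
      using as that by (auto simp: nat_trans_def sec act)
    have desc: "case_sum (\<xi> r) (\<zeta> r) u = case_sum (\<xi> r) (\<zeta> r) v" if "(u, v) \<in> R r" for r u v
      using that unfolding R_def
      by (induction rule: rtrancl_induct) (auto simp: E_def co)
    define \<eta> where "\<eta> = (\<lambda>r\<in>Obj C. \<lambda>y\<in>hom C r d.
      case_sum (\<xi> r) (\<zeta> r) (SOME u. u \<in> U r \<and> \<theta> r y = R r `` {u}))"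
    have \<eta>e: "\<eta> r y = case_sum (\<xi> r) (\<zeta> r) u"
      if y: "y \<in> hom C r d" and u: "u \<in> U r" "\<theta> r y = R r `` {u}" for r y u
    proof -
      define w where "w = (SOME u. u \<in> U r \<and> \<theta> r y = R r `` {u})"
      have "w \<in> U r \<and> \<theta> r y = R r `` {w}"
        unfolding w_def by (rule someI[where x = u]) (use u in blast)
      then have "(w, u) \<in> R r" using u(2) Rcls[of r w u] by simp
      from desc[OF this] show ?thesis using obj[OF y] y by (simp add: \<eta>_def w_def)
    qed
    have \<eta>p: "\<eta> r (Cmp C p x) = \<xi> r x" if x: "x \<in> hom C r b" for r x
      using \<eta>e[OF cmp[OF x p] _ t1[OF x]] x by (simp add: U_def)
    have \<eta>q: "\<eta> r (Cmp C q x) = \<zeta> r x" if x: "x \<in> hom C r c" for r x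
      using \<eta>e[OF cmp[OF x q] _ t2[OF x]] x by (simp add: U_def)
    have \<eta>n: "nat_trans C (yoneda C d) X \<eta>"
      unfolding nat_trans_def
    proof (intro conjI allI ballI)
      have "\<eta> r y \<in> sec X r" if "y \<in> hom C r d" for r y
        using surj[OF that] \<eta>p \<eta>q \<xi> \<zeta> by auto
      moreover have "\<eta> \<in> extensional (Obj C)"
        "\<And>r. r \<in> Obj C \<Longrightarrow> \<eta> r \<in> extensional (hom C r d)"
        by (auto simp: \<eta>_def)
      ultimately show "\<eta> \<in> (\<Pi>\<^sub>E r\<in>Obj C. sec (yoneda C d) r \<rightarrow>\<^sub>E sec X r)"
        by (simp add: PiE_iff sec)
    next
      fix r s h y assume h: "h \<in> hom C r s" and "y \<in> sec (yoneda C d) s"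
      then have y: "y \<in> hom C s d" by (simp add: sec)
      consider x where "x \<in> hom C s b" "y = Cmp C p x" | x where "x \<in> hom C s c" "y = Cmp C q x"
        using surj[OF y] by blast
      then show "\<eta> r (act (yoneda C d) h y) = act X h (\<eta> s y)"
      proof cases
        case 1
        then show ?thesis
          using assoc[OF h 1(1) p] \<eta>p[OF 1(1)] \<eta>p[OF cmp[OF h 1(1)]] \<xi>n[OF h 1(1)]
          by (simp add: act)
      next
        case 2
        then show ?thesis
          using assoc[OF h 2(1) q] \<eta>q[OF 2(1)] \<eta>q[OF cmp[OF h 2(1)]] \<zeta>n[OF h 2(1)]
          by (simp add: act)
      qed
    qed
    show "\<exists>!\<eta>. nat_trans C (yoneda C d) X \<eta> \<and>
      (\<forall>r\<in>Obj C. \<forall>x\<in>sec (yoneda C b) r. \<eta> r (yoneda_map C p r x) = \<xi> r x) \<and>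
      (\<forall>r\<in>Obj C. \<forall>x\<in>sec (yoneda C c) r. \<eta> r (yoneda_map C q r x) = \<zeta> r x)"
    proof (rule ex1I[of _ \<eta>])
      show "nat_trans C (yoneda C d) X \<eta> \<and>
        (\<forall>r\<in>Obj C. \<forall>x\<in>sec (yoneda C b) r. \<eta> r (yoneda_map C p r x) = \<xi> r x) \<and>
        (\<forall>r\<in>Obj C. \<forall>x\<in>sec (yoneda C c) r. \<eta> r (yoneda_map C q r x) = \<zeta> r x)"
        using \<eta>n \<eta>p \<eta>q by (simp add: sec ym[OF p] ym[OF q])
    next
      fix \<eta>'
      assume "nat_trans C (yoneda C d) X \<eta>' \<and>
        (\<forall>r\<in>Obj C. \<forall>x\<in>sec (yoneda C b) r. \<eta>' r (yoneda_map C p r x) = \<xi> r x) \<and>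
        (\<forall>r\<in>Obj C. \<forall>x\<in>sec (yoneda C c) r. \<eta>' r (yoneda_map C q r x) = \<zeta> r x)"
      then have n': "nat_trans C (yoneda C d) X \<eta>'"
        and p': "\<And>r x. x \<in> hom C r b \<Longrightarrow> \<eta>' r (Cmp C p x) = \<xi> r x"
        and q': "\<And>r x. x \<in> hom C r c \<Longrightarrow> \<eta>' r (Cmp C q x) = \<zeta> r x"
        using obj by (auto simp: sec ym[OF p] ym[OF q])
      have eq: "\<eta>' r y = \<eta> r y" if "y \<in> hom C r d" for r y
        using surj[OF that] p' q' \<eta>p \<eta>q by auto
      have m: "\<eta>' \<in> (\<Pi>\<^sub>E r\<in>Obj C. hom C r d \<rightarrow>\<^sub>E sec X r)" "\<eta> \<in> (\<Pi>\<^sub>E r\<in>Obj C. hom C r d \<rightarrow>\<^sub>E sec X r)"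
        using n' \<eta>n by (auto simp: nat_trans_def sec)
      show "\<eta>' = \<eta>"
      proof (rule PiE_ext[OF m])
        fix r assume r: "r \<in> Obj C"
        show "\<eta>' r = \<eta> r"
          by (rule PiE_ext[OF PiE_mem[OF m(1) r] PiE_mem[OF m(2) r]]) (rule eq)
      qed
    qed
  qed
qed

section \<open>EZ-categories\<close>

text \<open>
  The conditions on a degree function. They are meaningful when \<open>R\<close> satisfies
  \<open>category_axioms\<close>, which is not repeated among them.
\<close>

definition ez_category :: "('o, 'm) category \<Rightarrow> ('o \<Rightarrow> nat) \<Rightarrow> bool" where
  "ez_category R deg \<longleftrightarrow>
     (\<forall>m. mono_arr R m \<longrightarrow>
        (deg (Cod R m) = deg (Dom R m) \<longleftrightarrow> invertible_arr R m) \<and>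
        (deg (Cod R m) > deg (Dom R m) \<longleftrightarrow> \<not> invertible_arr R m)) \<and>
     (\<forall>f\<in>Arr R. \<exists>c\<in>Obj R. \<exists>e\<in>hom R (Dom R f) c. \<exists>m\<in>hom R c (Cod R f).
        split_epi R e \<and> mono_arr R m \<and> f = Cmp R m e) \<and>
     (\<forall>e\<^sub>1 e\<^sub>2. split_epi R e\<^sub>1 \<and> split_epi R e\<^sub>2 \<and> Dom R e\<^sub>1 = Dom R e\<^sub>2 \<longrightarrow>
        (\<exists>p q. strong_pushout R e\<^sub>1 e\<^sub>2 p q))"


section \<open>The wheeled graphical category\<close>

text \<open>
  Vertices and edges are drawn from \<open>nat\<close>, so that every isomorphism type of (finite) graphs
  occurs.
\<close>

record graph_mor =
  source :: "(nat, nat) graph"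
  target :: "(nat, nat) graph"
  emap :: "nat \<Rightarrow> nat"
  vmap :: "nat \<Rightarrow> (nat, nat) subgraph"

definition graph_mors :: "graph_mor set" where
  "graph_mors = {f. wf_graph (source f) \<and> wf_graph (target f) \<and>
     emap f \<in> extensional (edges (source f)) \<and> vmap f \<in> extensional (verts (source f)) \<and>
     graphical_map (source f) (target f) (emap f) (vmap f)}"

text \<open>The identity sends each vertex to its corolla, with all loops at the vertex cut.\<close>

definition graph_id :: "(nat, nat) graph \<Rightarrow> graph_mor" where
  "graph_id G = \<lparr>source = G, target = G,
     emap = (\<lambda>e\<in>edges G. e), vmap = (\<lambda>v\<in>verts G. Sub_Verts {v} {})\<rparr>"

text \<open>
  For \<open>g : K \<rightarrow> L\<close> and a subgraph \<open>X\<close> of \<open>K\<close>, the image of the composite \<open>X \<rightarrow> K \<rightarrow> L\<close>, whose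
  components are \<open>g\<^sub>0 \<circ> base\<close> and the restriction of \<open>g\<^sub>1\<close>.
\<close>

definition subgraph_image :: "graph_mor \<Rightarrow> (nat, nat) subgraph \<Rightarrow> (nat, nat) subgraph" where
  "subgraph_image g X =
     (THE Y. has_image (graph_of (source g) X) (target g) (emap g \<circ> base) (vmap g) Y)"

definition graph_comp :: "graph_mor \<Rightarrow> graph_mor \<Rightarrow> graph_mor" where
  "graph_comp g f = \<lparr>source = source f, target = target g,
     emap = (\<lambda>e\<in>edges (source f). emap g (emap f e)),
     vmap = (\<lambda>v\<in>verts (source f). subgraph_image g (vmap f v))\<rparr>"

definition wheeled_cat :: "((nat, nat) graph, graph_mor) category" where
  "wheeled_cat = \<lparr>Obj = {G. wf_graph G}, Arr = graph_mors, Dom = source, Cod = target,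
     Idn = graph_id, Cmp = graph_comp\<rparr>"

definition wheeled_cat_without_loop :: "((nat, nat) graph, graph_mor) category" where
  "wheeled_cat_without_loop = full_subcategory wheeled_cat {G. \<not> is_Exc_Loop G}"

end

theory Submission
  imports Defs
begin

text \<open>
  The condition on pushouts fails, whatever the degree. Let \<open>C\<^sub>n\<close> be the directed cycle with \<open>n\<close>
  vertices. Killing one of the two vertices of \<open>C\<^sub>2\<close>, that is, substituting the exceptional edge for
  it, gives two maps \<open>f, g : C\<^sub>2 \<rightarrow> C\<^sub>1\<close> (\<open>collapse\<close>). Each is a split epimorphism: a section
  (\<open>expand\<close>) sends the vertex of \<open>C\<^sub>1\<close> to the path through both vertices of \<open>C\<^sub>2\<close>. Suppose that
  \<open>p f = q g\<close>. On the vertex that \<open>g\<close> kills and \<open>f\<close> keeps, this equation says that \<open>p\<close> kills the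
  vertex of \<open>C\<^sub>1\<close>. Then the image of \<open>p\<close> is a graph with neither vertices nor legs, so the
  target of \<open>p\<close> is the exceptional loop (\<open>collapse_cocone_ends_in_loop\<close>).

  Without the exceptional loop among the objects, \<open>f\<close> and \<open>g\<close> therefore have no cocone at all. With
  the exceptional loop \<open>L\<close> there is a cocone, but it is not a strong pushout: in a strong pushout
  the identity of \<open>L\<close> would have to factor through \<open>p\<close> or \<open>q\<close>, and there is no map from \<open>L\<close> to
  \<open>C\<^sub>1\<close>, because maps from \<open>L\<close> end in exceptional loops. The lemma
  \<open>strong_pushout_reaches_loop\<close> makes this precise with a two-valued presheaf concentrated on
  exceptional loops.

  Most of the text computes images of concrete maps. The criterion \<open>has_image_Sub_VertsI\<close> reduces
  each such computation to a labelling of the edges to be glued.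
\<close>

section \<open>Edge classes of a substitution\<close>

abbreviation glued ::
  "('v, 'e) graph \<Rightarrow> ('v \<Rightarrow> 'e \<Rightarrow> 'd) \<Rightarrow> ('v \<Rightarrow> 'e \<Rightarrow> 'd) \<Rightarrow> ('e + 'v \<times> 'd) rel" where
  "glued G \<alpha> \<beta> \<equiv> (glue G \<alpha> \<beta> \<union> (glue G \<alpha> \<beta>)\<inverse>)\<^sup>*"

definition unglued_edges :: "('v, 'e) graph \<Rightarrow> ('v \<Rightarrow> ('w, 'd) graph) \<Rightarrow> ('e + 'v \<times> 'd) set" where
  "unglued_edges G P = Inl ` edges G \<union> Inr ` (SIGMA v : verts G. edges (P v))"

lemma Inl_in_unglued_edges [simp]: "Inl e \<in> unglued_edges G P \<longleftrightarrow> e \<in> edges G"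
  by (auto simp: unglued_edges_def)

lemma Inr_in_unglued_edges [simp]: "Inr (v, d) \<in> unglued_edges G P \<longleftrightarrow> v \<in> verts G \<and> d \<in> edges (P v)"
  by (auto simp: unglued_edges_def)

lemma ball_unglued_edges:
  "(\<forall>x\<in>unglued_edges G P. Q x) \<longleftrightarrow>
     (\<forall>e\<in>edges G. Q (Inl e)) \<and> (\<forall>v\<in>verts G. \<forall>d\<in>edges (P v). Q (Inr (v, d)))"
  by (auto simp: unglued_edges_def)

lemma glued_sym: "(x, y) \<in> glued G \<alpha> \<beta> \<Longrightarrow> (y, x) \<in> glued G \<alpha> \<beta>"
  by (rule symD[OF sym_rtrancl]) (auto simp: sym_def)

text \<open>
  Gluing preserves the label \<open>\<kappa>\<close>, and every edge is glued to the chosen representative \<open>\<rho>\<close> of its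
  label, so the classes are the fibres of \<open>\<kappa>\<close>.
\<close>

lemma subst_edges_fibres:
  assumes glue: "\<And>x y. (x, y) \<in> glue G \<alpha> \<beta> \<Longrightarrow> x \<in> unglued_edges G P \<and> y \<in> unglued_edges G P \<and> \<kappa> x = \<kappa> y"
    and rep: "\<And>d. d \<in> D \<Longrightarrow> \<rho> d \<in> unglued_edges G P \<and> \<kappa> (\<rho> d) = d"
    and path: "\<And>x. x \<in> unglued_edges G P \<Longrightarrow> \<kappa> x \<in> D \<and> (x, \<rho> (\<kappa> x)) \<in> glued G \<alpha> \<beta>"
  shows "subst_edges G P \<alpha> \<beta> = (\<lambda>d. {x \<in> unglued_edges G P. \<kappa> x = d}) ` D"
proof -
  have inv: "y \<in> unglued_edges G P \<and> \<kappa> y = \<kappa> x" if "(x, y) \<in> glued G \<alpha> \<beta>" "x \<in> unglued_edges G P" for x y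
    using that(1)
  proof (induction rule: rtrancl_induct)
    case (step y z)
    then show ?case using glue[of y z] glue[of z y] by auto
  qed (use that(2) in simp)
  have cls: "glued G \<alpha> \<beta> `` {x} = {y \<in> unglued_edges G P. \<kappa> y = \<kappa> x}" if x: "x \<in> unglued_edges G P" for x
  proof (intro equalityI subsetI)
    fix y assume "y \<in> {y \<in> unglued_edges G P. \<kappa> y = \<kappa> x}"
    then have y: "y \<in> unglued_edges G P" "\<kappa> y = \<kappa> x" by simp_all
    have "(\<rho> (\<kappa> x), y) \<in> glued G \<alpha> \<beta>"
      by (rule glued_sym) (use path[OF y(1)] y(2) in simp)
    with path[OF x] have "(x, y) \<in> glued G \<alpha> \<beta>" by (meson rtrancl_trans)
    then show "y \<in> glued G \<alpha> \<beta> `` {x}" by (rule ImageI) simp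
  next
    fix y assume "y \<in> glued G \<alpha> \<beta> `` {x}"
    then show "y \<in> {y \<in> unglued_edges G P. \<kappa> y = \<kappa> x}" using inv[of x y] x by simp
  qed
  have "subst_edges G P \<alpha> \<beta> = (\<lambda>x. glued G \<alpha> \<beta> `` {x}) ` unglued_edges G P"
    unfolding subst_edges_def unglued_edges_def[symmetric] quotient_def by blast
  also have "\<dots> = (\<lambda>x. {y \<in> unglued_edges G P. \<kappa> y = \<kappa> x}) ` unglued_edges G P"
    using cls by (rule image_cong[OF refl])
  also have "\<dots> = (\<lambda>d. {x \<in> unglued_edges G P. \<kappa> x = d}) ` \<kappa> ` unglued_edges G P"
    by (simp add: image_image)
  also have "\<kappa> ` unglued_edges G P = D"
  proof (intro equalityI subsetI)
    fix d assume "d \<in> D"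
    then show "d \<in> \<kappa> ` unglued_edges G P" using rep[of d] by (metis imageI)
  qed (use path in auto)
  finally show ?thesis .
qed

section \<open>Subgraphs and their legs\<close>

lemma ins_graph_of [simp]:
  "ins (graph_of K (Sub_Verts S I)) = In_Leg ` {e \<in> edges K - I. tgt K e \<in> Some ` S}"
  if "I \<subseteq> dom (src K)"
  using that by (auto simp: Let_def restrict_map_def)

lemma outs_graph_of [simp]:
  "outs (graph_of K (Sub_Verts S I)) = Out_Leg ` {e \<in> edges K - I. src K e \<in> Some ` S}"
  if "I \<subseteq> dom (tgt K)"
  using that by (auto simp: Let_def restrict_map_def)

lemma Sub_Verts_in_subgraphs:
  "Sub_Verts S I \<in> subgraphs K \<longleftrightarrow> S \<noteq> {} \<and> S \<subseteq> verts K \<and>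
     I \<subseteq> {e \<in> edges K. \<exists>u\<in>S. \<exists>v\<in>S. src K e = Some u \<and> tgt K e = Some v} \<and> connected_by K S I"
  by (auto simp: subgraphs_def)

lemma Sub_Verts_inner:
  assumes "Sub_Verts S I \<in> subgraphs K"
  shows "I \<subseteq> dom (src K)" "I \<subseteq> dom (tgt K)"
  using assms by (auto simp: Sub_Verts_in_subgraphs)

lemma Sub_Edge_in_subgraphs: "Sub_Edge e \<in> subgraphs K \<longleftrightarrow> e \<in> edges K"
  by (auto simp: subgraphs_def)

lemma Sub_Loop_in_subgraphs: "Sub_Loop \<in> subgraphs K \<longleftrightarrow> is_Exc_Loop K"
  by (auto simp: subgraphs_def)

text \<open>
  An edge cut into two legs contributes one input and one output, so only inputs together with outputs
  can collide under \<open>base\<close>. This makes the inverses of \<open>base\<close> in \<open>image_graph\<close> meaningful.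
\<close>

lemma inj_base_legs:
  assumes "X \<in> subgraphs K"
  shows "inj_on base (ins (graph_of K X))" "inj_on base (outs (graph_of K X))"
proof -
  have "inj_on base (ins (graph_of K X)) \<and> inj_on base (outs (graph_of K X))"
  proof (cases X)
    case (Sub_Verts S I)
    then show ?thesis using Sub_Verts_inner[of S I K] assms
      by (auto simp: inj_on_def simp del: graph_of.simps)
  qed auto
  then show "inj_on base (ins (graph_of K X))" "inj_on base (outs (graph_of K X))" by auto
qed

lemma verts_graph_of:
  "verts (graph_of K X) = (case X of Sub_Verts S I \<Rightarrow> S | _ \<Rightarrow> {})"
  by (cases X) (auto simp: Let_def)

lemma exceptional_graph_of:
  "is_Exc_Edge (graph_of K X) \<longleftrightarrow> (\<exists>e. X = Sub_Edge e)"
  "is_Exc_Loop (graph_of K X) \<longleftrightarrow> X = Sub_Loop"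
  by (cases X; auto simp: Let_def)+

lemma inner_edges_graph_of:
  assumes "Sub_Verts S I \<in> subgraphs K"
  shows "base ` {d \<in> edges (graph_of K (Sub_Verts S I)).
           src (graph_of K (Sub_Verts S I)) d \<noteq> None \<and> tgt (graph_of K (Sub_Verts S I)) d \<noteq> None} = I"
proof -
  let ?H = "graph_of K (Sub_Verts S I)"
  have "{d \<in> edges ?H. src ?H d \<noteq> None \<and> tgt ?H d \<noteq> None} = Full ` I"
  proof (rule set_eqI)
    fix d
    show "d \<in> {d \<in> edges ?H. src ?H d \<noteq> None \<and> tgt ?H d \<noteq> None} \<longleftrightarrow> d \<in> Full ` I"
      using Sub_Verts_inner[OF assms] by (cases d) (auto simp: Let_def)
  qed
  then show ?thesis by (simp add: image_image)
qed

section \<open>Uniqueness of images\<close>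

text \<open>
  What an isomorphism over a third graph preserves: the kind of the graph and the subsets of the third
  graph covered by vertices, edges and inner edges.
\<close>

lemma isomorphic_over_transfer:
  assumes "isomorphic_over H p q G p' q'"
  shows "is_Exc_Edge H = is_Exc_Edge G" "is_Exc_Loop H = is_Exc_Loop G"
    "p ` verts H = p' ` verts G" "q ` edges H = q' ` edges G"
    "q ` {e \<in> edges H. src H e \<noteq> None \<and> tgt H e \<noteq> None} =
     q' ` {e \<in> edges G. src G e \<noteq> None \<and> tgt G e \<noteq> None}"
proof -
  obtain \<phi> \<psi> where iso: "is_Exc_Edge H = is_Exc_Edge G" "is_Exc_Loop H = is_Exc_Loop G"
    and \<phi>: "bij_betw \<phi> (verts H) (verts G)" and \<psi>: "bij_betw \<psi> (edges H) (edges G)"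
    and ends: "\<And>e. e \<in> edges H \<Longrightarrow> src G (\<psi> e) = map_option \<phi> (src H e) \<and> tgt G (\<psi> e) = map_option \<phi> (tgt H e)"
    and over: "\<And>v. v \<in> verts H \<Longrightarrow> p' (\<phi> v) = p v" "\<And>e. e \<in> edges H \<Longrightarrow> q' (\<psi> e) = q e"
    using assms unfolding isomorphic_over_def graph_iso_def by blast
  show "is_Exc_Edge H = is_Exc_Edge G" "is_Exc_Loop H = is_Exc_Loop G" by fact+
  show "p ` verts H = p' ` verts G"
    using over(1) by (simp add: bij_betw_imp_surj_on[OF \<phi>, symmetric] image_image)
  show "q ` edges H = q' ` edges G"
    using over(2) by (simp add: bij_betw_imp_surj_on[OF \<psi>, symmetric] image_image)
  have "{e \<in> edges G. src G e \<noteq> None \<and> tgt G e \<noteq> None} =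
      \<psi> ` {e \<in> edges H. src H e \<noteq> None \<and> tgt H e \<noteq> None}"
    unfolding bij_betw_imp_surj_on[OF \<psi>, symmetric] using ends by auto
  then show "q ` {e \<in> edges H. src H e \<noteq> None \<and> tgt H e \<noteq> None} =
     q' ` {e \<in> edges G. src G e \<noteq> None \<and> tgt G e \<noteq> None}"
    using over(2) by (simp add: image_image)
qed

text \<open>
  A subgraph of \<open>K\<close> can be read off from what \<open>isomorphic_over_transfer\<close> preserves: \<open>S\<close> is the set of
  vertices and \<open>I\<close> the set of inner edges.
\<close>

lemma has_image_unique:
  assumes X: "has_image G K f\<^sub>0 f\<^sub>1 X" and Y: "has_image G K f\<^sub>0 f\<^sub>1 Y"
  shows "X = Y"
proof -
  note sub = X[unfolded has_image_def, THEN conjunct1] Y[unfolded has_image_def, THEN conjunct1]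
  note trX = isomorphic_over_transfer[OF X[unfolded has_image_def, THEN conjunct2]]
  note trY = isomorphic_over_transfer[OF Y[unfolded has_image_def, THEN conjunct2]]
  have kinds: "(\<exists>e. X = Sub_Edge e) = (\<exists>e. Y = Sub_Edge e)" "(X = Sub_Loop) = (Y = Sub_Loop)"
    using trX(1,2) trY(1,2) by (simp_all add: exceptional_graph_of)
  show ?thesis
  proof (cases X)
    case (Sub_Edge e)
    then obtain e' where "Y = Sub_Edge e'" using kinds by auto
    then show ?thesis using Sub_Edge trX(4) trY(4) by simp
  next
    case Sub_Loop
    then show ?thesis using kinds by simp
  next
    case (Sub_Verts S I)
    then obtain S' I' where Y': "Y = Sub_Verts S' I'" using kinds by (cases Y) auto
    have "S = S'" using trX(3) trY(3) unfolding Sub_Verts Y' by (simp add: verts_graph_of)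
    moreover have "I = I'"
      using trX(5) trY(5) inner_edges_graph_of[OF sub(1)[unfolded Sub_Verts]]
        inner_edges_graph_of[OF sub(2)[unfolded Y']]
      unfolding Sub_Verts Y' by (simp del: graph_of.simps)
    ultimately show ?thesis using Sub_Verts Y' by simp
  qed
qed

lemma subgraph_image_eqI:
  assumes "has_image (graph_of (source g) X) (target g) (emap g \<circ> base) (vmap g) Y"
  shows "subgraph_image g X = Y"
  unfolding subgraph_image_def
proof (rule the_equality)
  show "has_image (graph_of (source g) X) (target g) (emap g \<circ> base) (vmap g) Y" by fact
qed (rule has_image_unique[OF _ assms])

section \<open>A criterion for the image of a map\<close>

abbreviation in_legs where
  "in_legs K f\<^sub>0 f\<^sub>1 \<equiv> \<lambda>v e. the_inv_into (ins (graph_of K (f\<^sub>1 v))) base (f\<^sub>0 e)"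
abbreviation out_legs where
  "out_legs K f\<^sub>0 f\<^sub>1 \<equiv> \<lambda>v e. the_inv_into (outs (graph_of K (f\<^sub>1 v))) base (f\<^sub>0 e)"

lemma in_legs_eq:
  assumes "f\<^sub>1 v \<in> subgraphs K" "d \<in> ins (graph_of K (f\<^sub>1 v))" "base d = f\<^sub>0 e"
  shows "in_legs K f\<^sub>0 f\<^sub>1 v e = d"
  by (rule the_inv_into_f_eq[OF inj_base_legs(1)[OF assms(1)] assms(3,2)])

lemma out_legs_eq:
  assumes "f\<^sub>1 v \<in> subgraphs K" "d \<in> outs (graph_of K (f\<^sub>1 v))" "base d = f\<^sub>0 e"
  shows "out_legs K f\<^sub>0 f\<^sub>1 v e = d"
  by (rule the_inv_into_f_eq[OF inj_base_legs(2)[OF assms(1)] assms(3,2)])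

lemma ins_outs_subset_edges: "ins G \<subseteq> edges G" "outs G \<subseteq> edges G"
  by (cases G; auto)+

definition joined ::
  "('v, 'e) graph \<Rightarrow> ('w, 'd) graph \<Rightarrow> ('e \<Rightarrow> 'd) \<Rightarrow> ('v \<Rightarrow> ('w, 'd) subgraph) \<Rightarrow>
   ('e + 'v \<times> 'd sub_edge) rel" where
  "joined G K f\<^sub>0 f\<^sub>1 = glued G (in_legs K f\<^sub>0 f\<^sub>1) (out_legs K f\<^sub>0 f\<^sub>1)"

lemma joined_refl [simp]: "(x, x) \<in> joined G K f\<^sub>0 f\<^sub>1"
  by (simp add: joined_def)

lemma joined_sym: "(x, y) \<in> joined G K f\<^sub>0 f\<^sub>1 \<Longrightarrow> (y, x) \<in> joined G K f\<^sub>0 f\<^sub>1"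
  unfolding joined_def by (rule glued_sym)

lemma joined_trans:
  "(x, y) \<in> joined G K f\<^sub>0 f\<^sub>1 \<Longrightarrow> (y, z) \<in> joined G K f\<^sub>0 f\<^sub>1 \<Longrightarrow> (x, z) \<in> joined G K f\<^sub>0 f\<^sub>1"
  unfolding joined_def by (rule rtrancl_trans)

lemma joined_in:
  assumes "v \<in> verts G" "e \<in> ins_at G v"
    and "f\<^sub>1 v \<in> subgraphs K" "d \<in> ins (graph_of K (f\<^sub>1 v))" "base d = f\<^sub>0 e"
  shows "(Inl e, Inr (v, d)) \<in> joined G K f\<^sub>0 f\<^sub>1"
proof -
  have "in_legs K f\<^sub>0 f\<^sub>1 v e = d" using assms(3-5) by (rule in_legs_eq)
  then show ?thesis using assms(1,2) unfolding joined_def glue_def by blast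
qed

lemma joined_out:
  assumes "v \<in> verts G" "e \<in> outs_at G v"
    and "f\<^sub>1 v \<in> subgraphs K" "d \<in> outs (graph_of K (f\<^sub>1 v))" "base d = f\<^sub>0 e"
  shows "(Inl e, Inr (v, d)) \<in> joined G K f\<^sub>0 f\<^sub>1"
proof -
  have "out_legs K f\<^sub>0 f\<^sub>1 v e = d" using assms(3-5) by (rule out_legs_eq)
  then show ?thesis using assms(1,2) unfolding joined_def glue_def by blast
qed

text \<open>
  A way to recognise the graph with vertices \<open>S\<close> and inner edges \<open>I\<close> as the image. The labelling \<open>\<kappa>\<close>
  names, for each edge of \<open>G\<close> or of an inserted graph, the edge \<open>d\<close> of the subgraph that it becomes;
  \<open>\<rho> d\<close> is a chosen edge with label \<open>d\<close>, and \<open>\<sigma> w\<close> is the vertex of \<open>G\<close> whose inserted graph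
  contributes the vertex \<open>w\<close>. The edge classes are the fibres of \<open>\<kappa>\<close>, so \<open>\<kappa>\<close> induces the required
  isomorphism. All hypotheses are bounded quantifications, which rewriting decides when the graphs
  are given by explicit finite sets.
\<close>

lemma has_image_Sub_VertsI:
  fixes G :: "('v, 'e) graph" and K :: "('w, 'd) graph" and f\<^sub>1 :: "'v \<Rightarrow> ('w, 'd) subgraph"
    and S :: "'w set" and I :: "'d set"
  defines "P \<equiv> \<lambda>v. graph_of K (f\<^sub>1 v)" and "H \<equiv> graph_of K (Sub_Verts S I)"
  assumes X: "Sub_Verts S I \<in> subgraphs K"
    and sub: "\<forall>v\<in>verts G. f\<^sub>1 v \<in> subgraphs K"
    and own: "\<forall>v\<in>verts G. \<forall>w\<in>verts (P v). w \<in> S \<and> \<sigma> w = v"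
      "\<forall>w\<in>S. \<sigma> w \<in> verts G \<and> w \<in> verts (P (\<sigma> w))"
    and ins: "\<forall>v\<in>verts G. \<forall>e\<in>ins_at G v.
      \<exists>d\<in>ins (P v). base d = f\<^sub>0 e \<and> \<kappa> (Inr (v, d)) = \<kappa> (Inl e)"
    and outs: "\<forall>v\<in>verts G. \<forall>e\<in>outs_at G v.
      \<exists>d\<in>outs (P v). base d = f\<^sub>0 e \<and> \<kappa> (Inr (v, d)) = \<kappa> (Inl e)"
    and lab: "\<forall>x\<in>unglued_edges G P. \<kappa> x \<in> edges H \<and> base (\<kappa> x) = case_sum f\<^sub>0 (base \<circ> snd) x"
    and rep: "\<forall>d\<in>edges H. \<rho> d \<in> unglued_edges G P \<and> \<kappa> (\<rho> d) = d"
    and path: "\<forall>x\<in>unglued_edges G P. (x, \<rho> (\<kappa> x)) \<in> joined G K f\<^sub>0 f\<^sub>1"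
    and ends: "\<forall>en\<in>{src, tgt}. \<forall>d\<in>edges H. \<forall>w. en H d = Some w \<longleftrightarrow>
        (\<exists>v\<in>verts G. \<exists>d'\<in>edges (P v). \<kappa> (Inr (v, d')) = d \<and> en (P v) d' = Some w)"
  shows "has_image G K f\<^sub>0 f\<^sub>1 (Sub_Verts S I)"
proof -
  define V where "V = (SIGMA v : verts G. verts (P v))"
  define \<alpha> \<beta> where "\<alpha> = (\<lambda>v e. the_inv_into (ins (P v)) base (f\<^sub>0 e))"
    and "\<beta> = (\<lambda>v e. the_inv_into (outs (P v)) base (f\<^sub>0 e))"
  define F where "F d = {x \<in> unglued_edges G P. \<kappa> x = d}" for d
  have glue: "x \<in> unglued_edges G P \<and> y \<in> unglued_edges G P \<and> \<kappa> x = \<kappa> y" if xy: "(x, y) \<in> glue G \<alpha> \<beta>" for x y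
  proof -
    consider v e where "x = Inl e" "y = Inr (v, \<alpha> v e)" "v \<in> verts G" "e \<in> ins_at G v"
      | v e where "x = Inl e" "y = Inr (v, \<beta> v e)" "v \<in> verts G" "e \<in> outs_at G v"
      using xy unfolding glue_def by blast
    then show ?thesis
    proof cases
      case 1
      obtain d where d: "d \<in> ins (P v)" "base d = f\<^sub>0 e" "\<kappa> (Inr (v, d)) = \<kappa> (Inl e)"
        using ins 1(3,4) by blast
      then have "\<alpha> v e = d"
        unfolding \<alpha>_def P_def using sub 1 by (intro in_legs_eq) auto
      then show ?thesis using 1 d ins_outs_subset_edges(1)[of "P v"] by (auto simp: ins_at_def)
    next
      case 2
      obtain d where d: "d \<in> outs (P v)" "base d = f\<^sub>0 e" "\<kappa> (Inr (v, d)) = \<kappa> (Inl e)"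
        using outs 2(3,4) by blast
      then have "\<beta> v e = d"
        unfolding \<beta>_def P_def using sub 2 by (intro out_legs_eq) auto
      then show ?thesis using 2 d ins_outs_subset_edges(2)[of "P v"] by (auto simp: outs_at_def)
    qed
  qed
  have E: "subst_edges G P \<alpha> \<beta> = F ` edges H"
    unfolding F_def
    by (rule subst_edges_fibres[where \<rho> = \<rho>])
      (use glue rep lab path in \<open>auto simp: \<alpha>_def \<beta>_def P_def joined_def\<close>)
  have bij: "bij_betw snd V S"
    unfolding V_def by (rule bij_betw_byWitness[where f' = "\<lambda>w. (\<sigma> w, w)"]) (use own in auto)
  have S: "S \<noteq> {}" using X by (simp add: Sub_Verts_in_subgraphs)
  then have V: "V \<noteq> {}" using bij by (auto simp: bij_betw_def V_def)
  have HH: "verts H = S" "\<not> is_Exc_Edge H" "\<not> is_Exc_Loop H"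
    by (simp_all add: H_def Let_def)
  define M where "M = image_graph G K f\<^sub>0 f\<^sub>1"
  have M: "M = Ordinary V (F ` edges H)
      (subst_end src G P |` (F ` edges H)) (subst_end tgt G P |` (F ` edges H))"
    using V E by (simp add: M_def image_graph_def subst_def Let_def P_def \<alpha>_def \<beta>_def V_def)
  have lab_F: "the_elem (\<kappa> ` F d) = d" if "d \<in> edges H" for d
  proof -
    have "\<kappa> ` F d = {d}" using rep that unfolding F_def by force
    then show ?thesis by simp
  qed
  \<comment> \<open>The ends of a class lie over a single vertex of \<open>H\<close>; as \<open>snd\<close> is injective on \<open>V\<close>, the
    definite description in \<open>subst_end\<close> is well defined.\<close>
  have end_F: "map_option snd (subst_end en G P (F d)) = en H d"
    if d: "d \<in> edges H" and en: "en \<in> {src, tgt}"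
      and dom: "\<And>v d w. v \<in> verts G \<Longrightarrow> d \<in> edges (P v) \<Longrightarrow> en (P v) d = Some w \<Longrightarrow> w \<in> verts (P v)"
    for en d
  proof -
    define N where "N = {(v, w). v \<in> verts G \<and> (\<exists>d'. Inr (v, d') \<in> F d \<and> en (P v) d' = Some w)}"
    have N: "en H d = Some w \<longleftrightarrow> (\<exists>v. (v, w) \<in> N)" for w
      unfolding ends[rule_format, OF en d] by (auto simp: N_def F_def)
    have "N \<subseteq> V" using dom by (auto simp: N_def V_def F_def)
    have se: "subst_end en G P (F d) = (if N = {} then None else Some (THE x. x \<in> N))"
      unfolding subst_end_def N_def by (simp add: Let_def)
    show ?thesis
    proof (cases "N = {}")
      case True
      then have "en H d = None" using N by (cases "en H d") auto
      then show ?thesis using True se by simp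
    next
      case False
      then obtain v w where vw: "(v, w) \<in> N" by auto
      have "x = (v, w)" if "x \<in> N" for x
      proof -
        have "en H d = Some (snd x)" "en H d = Some w" using N vw that by (metis prod.collapse)+
        then have "snd x = snd (v, w)" by simp
        then show ?thesis
          using bij that vw \<open>N \<subseteq> V\<close> unfolding V_def bij_betw_def inj_on_def by blast
      qed
      then have "(THE x. x \<in> N) = (v, w)" using vw by (rule the_equality[rotated])
      moreover have "en H d = Some w" using N vw by blast
      ultimately show ?thesis using se False by simp
    qed
  qed
  have wf: "src (graph_of K Y) d = Some w \<Longrightarrow> w \<in> verts (graph_of K Y)"
    "tgt (graph_of K Y) d = Some w \<Longrightarrow> w \<in> verts (graph_of K Y)"
    if "Y \<in> subgraphs K" for Y d w
    using that
    by (cases Y; cases d; auto simp: Let_def restrict_map_def Sub_Verts_in_subgraphs split: if_splits)+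
  have "graph_iso M H snd (\<lambda>c. the_elem (\<kappa> ` c))"
    unfolding graph_iso_def
  proof (intro conjI ballI)
    show "bij_betw snd (verts M) (verts H)" using bij by (simp add: M HH V_def)
    show "bij_betw (\<lambda>c. the_elem (\<kappa> ` c)) (edges M) (edges H)"
      by (rule bij_betw_byWitness[where f' = F]) (auto simp: M lab_F)
  next
    fix c assume "c \<in> edges M"
    then obtain d where d: "d \<in> edges H" "c = F d" by (auto simp: M)
    have "map_option snd (subst_end src G P (F d)) = src H d"
      by (rule end_F[OF d(1)]) (use wf(1) sub in \<open>auto simp: P_def\<close>)
    moreover have "map_option snd (subst_end tgt G P (F d)) = tgt H d"
      by (rule end_F[OF d(1)]) (use wf(2) sub in \<open>auto simp: P_def\<close>)
    ultimately show "src H (the_elem (\<kappa> ` c)) = map_option snd (src M c)"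
      "tgt H (the_elem (\<kappa> ` c)) = map_option snd (tgt M c)"
      using d by (auto simp: lab_F M)
  qed (auto simp: M HH)
  moreover have "base (the_elem (\<kappa> ` c)) = image_edge_map f\<^sub>0 c" if "c \<in> edges M" for c
  proof -
    obtain d where d: "d \<in> edges H" "c = F d" using \<open>c \<in> edges M\<close> by (auto simp: M)
    have "case_sum f\<^sub>0 (\<lambda>(v, d). base d) x = base d" if "x \<in> F d" for x
      using lab that by (cases x) (auto simp: F_def)
    moreover have "\<rho> d \<in> F d" using rep d(1) by (simp add: F_def)
    ultimately have "case_sum f\<^sub>0 (\<lambda>(v, d). base d) ` F d = {base d}" by force
    then show ?thesis using d by (simp add: lab_F image_edge_map_def)
  qed
  ultimately show ?thesis
    unfolding has_image_def isomorphic_over_def M_def[symmetric] H_def[symmetric]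
    using X by auto
qed

section \<open>Images of edges, loops and corollas\<close>

lemma has_image_edge:
  assumes "f\<^sub>0 y \<in> edges K"
  shows "has_image (Exc_Edge y) K f\<^sub>0 f\<^sub>1 (Sub_Edge (f\<^sub>0 y))"
proof -
  have "image_graph (Exc_Edge y) K f\<^sub>0 f\<^sub>1 = Exc_Edge {Inl y}"
    by (simp add: image_graph_def subst_def subst_edges_def glue_def quotient_def)
  moreover have "isomorphic_over (Exc_Edge {Inl y}) snd (image_edge_map f\<^sub>0)
      (graph_of K (Sub_Edge (f\<^sub>0 y))) (\<lambda>w. w) base"
    unfolding isomorphic_over_def
    by (rule exI[of _ undefined], rule exI[of _ "\<lambda>_. Full (f\<^sub>0 y)"])
      (simp add: graph_iso_def bij_betw_def image_edge_map_def)
  ultimately show ?thesis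
    using assms by (simp add: has_image_def Sub_Edge_in_subgraphs)
qed

lemma has_image_loop:
  assumes "f\<^sub>0 y = z"
  shows "has_image (Exc_Loop y) (Exc_Loop z) f\<^sub>0 f\<^sub>1 Sub_Loop"
proof -
  have "image_graph (Exc_Loop y) (Exc_Loop z) f\<^sub>0 f\<^sub>1 = Exc_Loop {Inl y}"
    by (simp add: image_graph_def subst_def subst_edges_def glue_def quotient_def)
  moreover have "isomorphic_over (Exc_Loop {Inl y}) snd (image_edge_map f\<^sub>0)
      (graph_of (Exc_Loop z) Sub_Loop) (\<lambda>w. w) base"
    unfolding isomorphic_over_def
    by (rule exI[of _ undefined], rule exI[of _ "\<lambda>_. Full z"])
      (simp add: graph_iso_def bij_betw_def image_edge_map_def assms)
  ultimately show ?thesis by (simp add: has_image_def Sub_Loop_in_subgraphs)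
qed

lemma graphical_map_legs:
  assumes "graphical_map G K f\<^sub>0 f\<^sub>1" "v \<in> verts G"
  shows "f\<^sub>0 ` ins_at G v = base ` ins (graph_of K (f\<^sub>1 v))"
    "f\<^sub>0 ` outs_at G v = base ` outs (graph_of K (f\<^sub>1 v))"
  using assms by (auto simp: graphical_map_def bij_betw_def)

lemma graph_mors_iff:
  "f \<in> graph_mors \<longleftrightarrow> wf_graph (source f) \<and> wf_graph (target f) \<and>
    emap f \<in> extensional (edges (source f)) \<and> vmap f \<in> extensional (verts (source f)) \<and>
    graphical_map (source f) (target f) (emap f) (vmap f)"
  by (simp add: graph_mors_def)

lemma subgraph_image_edge:
  assumes "g \<in> graph_mors" "x \<in> edges (source g)"
  shows "subgraph_image g (Sub_Edge x) = Sub_Edge (emap g x)"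
proof (rule subgraph_image_eqI)
  have "emap g x \<in> edges (target g)"
    using assms by (auto simp: graph_mors_iff graphical_map_def)
  then show "has_image (graph_of (source g) (Sub_Edge x)) (target g) (emap g \<circ> base) (vmap g)
      (Sub_Edge (emap g x))"
    using has_image_edge[of "emap g \<circ> base" "Full x" "target g"] by simp
qed

text \<open>
  Substituting \<open>X\<close> into a corolla gives back \<open>X\<close>: every leg of the corolla is glued to the matching leg
  of \<open>X\<close>, so all labels are represented within \<open>X\<close>.
\<close>

lemma subgraph_image_corolla:
  assumes g: "g \<in> graph_mors" and v: "v \<in> verts (source g)" and X: "vmap g v = Sub_Verts S I"
  shows "subgraph_image g (Sub_Verts {v} {}) = Sub_Verts S I"
proof (rule subgraph_image_eqI)
  define K L where "K = source g" and "L = target g"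
  define C where "C = graph_of K (Sub_Verts {v} {})"
  define H where "H = graph_of L (vmap g v)"
  have gm: "graphical_map K L (emap g) (vmap g)" using g by (simp add: graph_mors_iff K_def L_def)
  then have sub: "vmap g v \<in> subgraphs L" using v by (auto simp: graphical_map_def K_def)
  have vC: "verts C = {v}" by (simp add: C_def Let_def)
  have insC: "ins_at C v = In_Leg ` ins_at K v"
  proof (rule set_eqI)
    fix d show "d \<in> ins_at C v \<longleftrightarrow> d \<in> In_Leg ` ins_at K v"
      by (cases d) (auto simp: C_def Let_def ins_at_def)
  qed
  have outsC: "outs_at C v = Out_Leg ` outs_at K v"
  proof (rule set_eqI)
    fix d show "d \<in> outs_at C v \<longleftrightarrow> d \<in> Out_Leg ` outs_at K v"
      by (cases d) (auto simp: C_def Let_def outs_at_def)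
  qed
  have edgesC: "edges C = In_Leg ` ins_at K v \<union> Out_Leg ` outs_at K v"
    by (auto simp: C_def Let_def outs_at_def ins_at_def)
  note legs = graphical_map_legs[OF gm v[folded K_def], folded H_def]
  have ex_in: "\<exists>d. d \<in> ins H \<and> base d = emap g e" if "e \<in> ins_at K v" for e
    using imageI[OF that, of "emap g"] unfolding legs by auto
  have ex_out: "\<exists>d. d \<in> outs H \<and> base d = emap g e" if "e \<in> outs_at K v" for e
    using imageI[OF that, of "emap g"] unfolding legs by auto
  define i where "i e = (SOME d. d \<in> ins H \<and> base d = emap g e)" for e
  define j where "j e = (SOME d. d \<in> outs H \<and> base d = emap g e)" for e
  have i: "i e \<in> ins H" "base (i e) = emap g e" if "e \<in> ins_at K v" for e
    using someI_ex[OF ex_in[OF that]] by (simp_all add: i_def)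
  have j: "j e \<in> outs H" "base (j e) = emap g e" if "e \<in> outs_at K v" for e
    using someI_ex[OF ex_out[OF that]] by (simp_all add: j_def)
  \<comment> \<open>A corolla has no inner edge, whence the default value at \<open>Full\<close>.\<close>
  define \<kappa> where "\<kappa> = case_sum (case_sub_edge undefined i j) (snd :: nat \<times> nat sub_edge \<Rightarrow> _)"
  have path_in: "(Inl (In_Leg e), Inr (v, i e)) \<in> joined C L (emap g \<circ> base) (vmap g)"
    if "e \<in> ins_at K v" for e
    by (rule joined_in) (use i[OF that] sub that in \<open>auto simp: vC insC H_def\<close>)
  have path_out: "(Inl (Out_Leg e), Inr (v, j e)) \<in> joined C L (emap g \<circ> base) (vmap g)"
    if "e \<in> outs_at K v" for e
    by (rule joined_out) (use j[OF that] sub that in \<open>auto simp: vC outsC H_def\<close>)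
  have H: "graph_of L (vmap g v) = H" "graph_of L (Sub_Verts S I) = H" "verts H = S"
    by (simp_all add: H_def X Let_def)
  have "has_image C L (emap g \<circ> base) (vmap g) (Sub_Verts S I)"
    using sub i j ins_outs_subset_edges[of H] path_in path_out
    by (intro has_image_Sub_VertsI[where \<kappa> = \<kappa> and \<rho> = "\<lambda>d. Inr (v, d)" and \<sigma> = "\<lambda>_. v"])
      (auto simp: ball_unglued_edges vC insC outsC edgesC \<kappa>_def H X[symmetric])
  then show "has_image (graph_of (source g) (Sub_Verts {v} {})) (target g) (emap g \<circ> base)
      (vmap g) (Sub_Verts S I)"
    by (simp add: C_def K_def L_def)
qed

section \<open>Two cycles and the maps between them\<close>

definition cycle1 :: "(nat, nat) graph" where
  "cycle1 = Ordinary {0} {0} [0 \<mapsto> 0] [0 \<mapsto> 0]"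

text \<open>
  Keeping the names as parameters lets \<open>cycle2_sym\<close> exchange the two vertices.
\<close>

definition cycle2 :: "nat \<Rightarrow> nat \<Rightarrow> nat \<Rightarrow> nat \<Rightarrow> (nat, nat) graph" where
  "cycle2 u v a b = Ordinary {u, v} {a, b} [a \<mapsto> u, b \<mapsto> v] [a \<mapsto> v, b \<mapsto> u]"

lemma cycle1_simps [simp]:
  "verts cycle1 = {0}" "edges cycle1 = {0}" "src cycle1 = [0 \<mapsto> 0]" "tgt cycle1 = [0 \<mapsto> 0]"
  "ins cycle1 = {}" "outs cycle1 = {}" "ins_at cycle1 0 = {0}" "outs_at cycle1 0 = {0}"
  "\<not> is_Exc_Loop cycle1"
  by (auto simp: cycle1_def ins_at_def outs_at_def)

lemma cycle2_simps [simp]: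
  "verts (cycle2 u v a b) = {u, v}" "edges (cycle2 u v a b) = {a, b}"
  "src (cycle2 u v a b) = [a \<mapsto> u, b \<mapsto> v]" "tgt (cycle2 u v a b) = [a \<mapsto> v, b \<mapsto> u]"
  "\<not> is_Exc_Loop (cycle2 u v a b)"
  by (auto simp: cycle2_def)

lemma cycle2_sym: "u \<noteq> v \<Longrightarrow> a \<noteq> b \<Longrightarrow> cycle2 u v a b = cycle2 v u b a"
  by (auto simp: cycle2_def fun_upd_twist)

lemma cycle2_at:
  assumes "u \<noteq> v" "a \<noteq> b"
  shows "ins_at (cycle2 u v a b) u = {b}" "outs_at (cycle2 u v a b) u = {a}"
    "ins_at (cycle2 u v a b) v = {a}" "outs_at (cycle2 u v a b) v = {b}"
  using assms by (auto simp: ins_at_def outs_at_def)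

lemma connected_by_singleton: "connected_by G {v} I"
  by (simp add: connected_by_def)

lemma connected_by_pair:
  assumes "e \<in> I" "src G e = Some u" "tgt G e = Some v"
  shows "connected_by G {u, v} I"
proof -
  define R where "R = {(u, v). \<exists>e\<in>I. src G e = Some u \<and> tgt G e = Some v}"
  have "(u, v) \<in> R" using assms by (auto simp: R_def)
  then have "(u, v) \<in> (R \<union> R\<inverse>)\<^sup>*" "(v, u) \<in> (R \<union> R\<inverse>)\<^sup>*" by auto
  then show ?thesis unfolding connected_by_def R_def[symmetric] Let_def by auto
qed

lemma wf_cycle1: "wf_graph cycle1"
  by (auto simp: cycle1_def connected_by_singleton)

lemma wf_cycle2: "u \<noteq> v \<Longrightarrow> a \<noteq> b \<Longrightarrow> wf_graph (cycle2 u v a b)"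
  by (auto simp: cycle2_def intro!: connected_by_pair[of a])

lemma subgraphs_cycle1:
  "Sub_Edge 0 \<in> subgraphs cycle1" "Sub_Verts {0} {} \<in> subgraphs cycle1"
  "Sub_Verts {0} {0} \<in> subgraphs cycle1"
  by (simp_all add: Sub_Edge_in_subgraphs Sub_Verts_in_subgraphs connected_by_singleton)

lemma subgraphs_cycle2:
  assumes "u \<noteq> v" "a \<noteq> b"
  shows "Sub_Verts {u, v} {a} \<in> subgraphs (cycle2 u v a b)"
    "Sub_Verts {u, v} {a, b} \<in> subgraphs (cycle2 u v a b)"
  using assms by (auto simp: Sub_Verts_in_subgraphs intro: connected_by_pair[of a])

text \<open>
  By \<open>cycle2_sym\<close>, \<open>collapse v u b a\<close> starts at the same graph and kills the other
  vertex.
\<close>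

definition collapse :: "nat \<Rightarrow> nat \<Rightarrow> nat \<Rightarrow> nat \<Rightarrow> graph_mor" where
  "collapse u v a b = \<lparr>source = cycle2 u v a b, target = cycle1, emap = (\<lambda>e\<in>{a, b}. 0),
     vmap = (\<lambda>z\<in>{u, v}. if z = u then Sub_Edge 0 else Sub_Verts {0} {})\<rparr>"

text \<open>
  The edge goes to the one that the path through \<open>u\<close> and \<open>v\<close> leaves out, so that the image closes up to
  the whole cycle.
\<close>

definition expand :: "nat \<Rightarrow> nat \<Rightarrow> nat \<Rightarrow> nat \<Rightarrow> graph_mor" where
  "expand u v a b = \<lparr>source = cycle1, target = cycle2 u v a b, emap = (\<lambda>e\<in>{0}. b),
     vmap = (\<lambda>z\<in>{0}. Sub_Verts {u, v} {a})\<rparr>"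

lemma graph_of_cycle1:
  "graph_of cycle1 (Sub_Verts {0} {}) =
     Ordinary {0} {In_Leg 0, Out_Leg 0} [Out_Leg 0 \<mapsto> 0] [In_Leg 0 \<mapsto> 0]"
  "graph_of cycle1 (Sub_Verts {0} {0}) = Ordinary {0} {Full 0} [Full 0 \<mapsto> 0] [Full 0 \<mapsto> 0]"
  by (auto simp: Let_def fun_eq_iff restrict_map_def split: sub_edge.splits)

lemma graph_of_cycle2:
  assumes "u \<noteq> v" "a \<noteq> b"
  shows "graph_of (cycle2 u v a b) (Sub_Verts {u, v} {a}) =
      Ordinary {u, v} {Full a, In_Leg b, Out_Leg b} [Full a \<mapsto> u, Out_Leg b \<mapsto> v] [Full a \<mapsto> v, In_Leg b \<mapsto> u]"
    "graph_of (cycle2 u v a b) (Sub_Verts {u, v} {a, b}) =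
      Ordinary {u, v} {Full a, Full b} [Full a \<mapsto> u, Full b \<mapsto> v] [Full a \<mapsto> v, Full b \<mapsto> u]"
  using assms by (auto simp: Let_def fun_eq_iff restrict_map_def split: sub_edge.splits)

text \<open>
  The data of the four subgraphs that occur, as rewrite rules. They replace the defining equation of
  \<open>graph_of\<close>, which produces set comprehensions.
\<close>

lemma corolla_cycle1:
  "verts (graph_of cycle1 (Sub_Verts {0} {})) = {0}"
  "edges (graph_of cycle1 (Sub_Verts {0} {})) = {In_Leg 0, Out_Leg 0}"
  "src (graph_of cycle1 (Sub_Verts {0} {})) = [Out_Leg 0 \<mapsto> 0]"
  "tgt (graph_of cycle1 (Sub_Verts {0} {})) = [In_Leg 0 \<mapsto> 0]"
  "ins (graph_of cycle1 (Sub_Verts {0} {})) = {In_Leg 0}"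
  "outs (graph_of cycle1 (Sub_Verts {0} {})) = {Out_Leg 0}"
  unfolding graph_of_cycle1 by auto

lemma whole_cycle1:
  "verts (graph_of cycle1 (Sub_Verts {0} {0})) = {0}"
  "edges (graph_of cycle1 (Sub_Verts {0} {0})) = {Full 0}"
  "src (graph_of cycle1 (Sub_Verts {0} {0})) = [Full 0 \<mapsto> 0]"
  "tgt (graph_of cycle1 (Sub_Verts {0} {0})) = [Full 0 \<mapsto> 0]"
  unfolding graph_of_cycle1 by auto

lemma path_cycle2:
  assumes "u \<noteq> v" "a \<noteq> b"
  shows "verts (graph_of (cycle2 u v a b) (Sub_Verts {u, v} {a})) = {u, v}"
    "edges (graph_of (cycle2 u v a b) (Sub_Verts {u, v} {a})) = {Full a, In_Leg b, Out_Leg b}"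
    "src (graph_of (cycle2 u v a b) (Sub_Verts {u, v} {a})) = [Full a \<mapsto> u, Out_Leg b \<mapsto> v]"
    "tgt (graph_of (cycle2 u v a b) (Sub_Verts {u, v} {a})) = [Full a \<mapsto> v, In_Leg b \<mapsto> u]"
    "ins (graph_of (cycle2 u v a b) (Sub_Verts {u, v} {a})) = {In_Leg b}"
    "outs (graph_of (cycle2 u v a b) (Sub_Verts {u, v} {a})) = {Out_Leg b}"
  unfolding graph_of_cycle2[OF assms] by auto

lemma whole_cycle2:
  assumes "u \<noteq> v" "a \<noteq> b"
  shows "verts (graph_of (cycle2 u v a b) (Sub_Verts {u, v} {a, b})) = {u, v}"
    "edges (graph_of (cycle2 u v a b) (Sub_Verts {u, v} {a, b})) = {Full a, Full b}"
    "src (graph_of (cycle2 u v a b) (Sub_Verts {u, v} {a, b})) = [Full a \<mapsto> u, Full b \<mapsto> v]"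
    "tgt (graph_of (cycle2 u v a b) (Sub_Verts {u, v} {a, b})) = [Full a \<mapsto> v, Full b \<mapsto> u]"
  unfolding graph_of_cycle2[OF assms] by auto

declare graph_of.simps(3) [simp del]

lemma collapse_in_graph_mors:
  assumes "u \<noteq> v" "a \<noteq> b"
  shows "collapse u v a b \<in> graph_mors"
proof -
  define G where "G = cycle2 u v a b"
  define f0 f1 where "f0 = emap (collapse u v a b)" and "f1 = vmap (collapse u v a b)"
  have G: "verts G = {u, v}" "edges G = {a, b}" by (simp_all add: G_def)
  note at = cycle2_at[OF assms, folded G_def]
  have f: "f0 a = 0" "f0 b = 0" "f1 u = Sub_Edge 0" "f1 v = Sub_Verts {0} {}"
    using assms by (auto simp: collapse_def f0_def f1_def)
  \<comment> \<open>All five edges are glued together through the exceptional edge inserted at \<open>u\<close>.\<close>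
  have j: "(Inl b, Inr (u, Full 0)) \<in> joined G cycle1 f0 f1"
    "(Inl a, Inr (u, Full 0)) \<in> joined G cycle1 f0 f1"
    "(Inl a, Inr (v, In_Leg 0)) \<in> joined G cycle1 f0 f1"
    "(Inl b, Inr (v, Out_Leg 0)) \<in> joined G cycle1 f0 f1"
    by (rule joined_in joined_out;
        simp add: at G f subgraphs_cycle1 corolla_cycle1 whole_cycle1)+
  note j' = joined_trans[OF joined_sym[OF j(3)] j(2)] joined_trans[OF joined_sym[OF j(4)] j(1)]
  have "has_image G cycle1 f0 f1 (Sub_Verts {0} {0})"
    by (rule has_image_Sub_VertsI[where
          \<kappa> = "\<lambda>_. Full 0" and \<rho> = "\<lambda>_. Inr (u, Full 0)" and \<sigma> = "\<lambda>_. v"])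
      (simp_all add: ball_unglued_edges at G f j j' subgraphs_cycle1 corolla_cycle1 whole_cycle1)
  moreover have "f0 \<in> extensional (edges G)" "f1 \<in> extensional (verts G)"
    by (simp_all add: f0_def f1_def collapse_def G_def)
  ultimately have "wf_graph G \<and> wf_graph cycle1 \<and> f0 \<in> extensional (edges G) \<and>
      f1 \<in> extensional (verts G) \<and> graphical_map G cycle1 f0 f1"
    using wf_cycle1 wf_cycle2[OF assms]
    unfolding graphical_map_def Pi_iff
    by (simp add: G at f subgraphs_cycle1 corolla_cycle1 whole_cycle1 bij_betw_def)
      (auto simp: G_def)
  then show ?thesis by (simp add: graph_mors_iff f0_def f1_def G_def collapse_def)
qed

lemma expand_in_graph_mors:
  assumes "u \<noteq> v" "a \<noteq> b"
  shows "expand u v a b \<in> graph_mors"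
proof -
  define K where "K = cycle2 u v a b"
  define f0 f1 where "f0 = emap (expand u v a b)" and "f1 = vmap (expand u v a b)"
  have f: "f0 0 = b" "f1 0 = Sub_Verts {u, v} {a}" by (simp_all add: expand_def f0_def f1_def)
  have K: "verts K = {u, v}" "edges K = {a, b}" by (simp_all add: K_def)
  note sub = subgraphs_cycle2[OF assms, folded K_def]
  note gr = path_cycle2[OF assms, folded K_def] whole_cycle2[OF assms, folded K_def]
  note ne = assms assms[symmetric]
  \<comment> \<open>The edge of the small cycle joins the two legs of the path; the inner edge \<open>a\<close> stays apart.\<close>
  have j: "(Inl 0, Inr (0, In_Leg b)) \<in> joined cycle1 K f0 f1"
    "(Inl 0, Inr (0, Out_Leg b)) \<in> joined cycle1 K f0 f1"
    by (rule joined_in joined_out; simp add: f sub gr ne)+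
  have "has_image cycle1 K f0 f1 (Sub_Verts {u, v} {a, b})"
    by (rule has_image_Sub_VertsI[where
          \<kappa> = "\<lambda>x. if x = Inr (0, Full a) then Full a else Full b" and
          \<rho> = "\<lambda>d. if d = Full a then Inr (0, Full a) else Inl 0" and \<sigma> = "\<lambda>_. 0"])
      (auto simp add: ball_unglued_edges f sub gr ne j joined_sym[OF j(1)] joined_sym[OF j(2)])
  moreover have "f0 \<in> extensional (edges cycle1)" "f1 \<in> extensional (verts cycle1)"
    by (simp_all add: f0_def f1_def expand_def)
  ultimately have "wf_graph K \<and> wf_graph cycle1 \<and> f0 \<in> extensional (edges cycle1) \<and>
      f1 \<in> extensional (verts cycle1) \<and> graphical_map cycle1 K f0 f1"
    using wf_cycle1 wf_cycle2[OF assms]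
    unfolding graphical_map_def Pi_iff
    by (simp add: K f sub gr ne bij_betw_def)
      (auto simp: K_def)
  then show ?thesis by (simp add: graph_mors_iff f0_def f1_def K_def expand_def)
qed

text \<open>
  The exceptional edge inserted at \<open>u\<close> merges the input leg of the path with its inner edge, which
  leaves the corolla at \<open>v\<close>. This is why \<open>expand\<close> is a section.
\<close>

lemma collapse_image:
  assumes "u \<noteq> v" "a \<noteq> b"
  shows "subgraph_image (collapse u v a b) (Sub_Verts {u, v} {a}) = Sub_Verts {0} {}"
proof (rule subgraph_image_eqI)
  define G where "G = graph_of (cycle2 u v a b) (Sub_Verts {u, v} {a})"
  define f0 f1 where "f0 = emap (collapse u v a b) \<circ> base" and "f1 = vmap (collapse u v a b)"
  note ne = assms assms[symmetric]
  have f: "f0 (Full a) = 0" "f0 (In_Leg b) = 0" "f0 (Out_Leg b) = 0"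
    "f1 u = Sub_Edge 0" "f1 v = Sub_Verts {0} {}"
    using assms by (auto simp: collapse_def f0_def f1_def)
  have G: "G = Ordinary {u, v} {Full a, In_Leg b, Out_Leg b}
      [Full a \<mapsto> u, Out_Leg b \<mapsto> v] [Full a \<mapsto> v, In_Leg b \<mapsto> u]"
    using assms by (simp add: G_def graph_of_cycle2)
  have at: "ins_at G u = {In_Leg b}" "outs_at G u = {Full a}" "ins_at G v = {Full a}"
    "outs_at G v = {Out_Leg b}"
    using assms by (auto simp: G ins_at_def outs_at_def)
  have vG: "verts G = {u, v}" "edges G = {Full a, In_Leg b, Out_Leg b}" by (simp_all add: G)
  \<comment> \<open>Killing \<open>u\<close> glues the leg into \<open>u\<close>, the edge \<open>a\<close> and the input of the corolla at \<open>v\<close>.\<close>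
  have j: "(Inl (In_Leg b), Inr (u, Full 0)) \<in> joined G cycle1 f0 f1"
    "(Inl (Full a), Inr (u, Full 0)) \<in> joined G cycle1 f0 f1"
    "(Inl (Full a), Inr (v, In_Leg 0)) \<in> joined G cycle1 f0 f1"
    "(Inl (Out_Leg b), Inr (v, Out_Leg 0)) \<in> joined G cycle1 f0 f1"
    by (rule joined_in joined_out;
        simp add: at vG f subgraphs_cycle1 corolla_cycle1 whole_cycle1)+
  note j' = joined_trans[OF j(1) joined_sym[OF j(2)]] j[THEN joined_sym]
  have "has_image G cycle1 f0 f1 (Sub_Verts {0} {})"
    by (rule has_image_Sub_VertsI[where
        \<kappa> = "\<lambda>x. if x \<in> {Inl (Out_Leg b), Inr (v, Out_Leg 0)} then Out_Leg 0 else In_Leg 0" and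
        \<rho> = "\<lambda>d. if d = In_Leg 0 then Inl (Full a) else Inl (Out_Leg b)" and \<sigma> = "\<lambda>_. v"])
     (auto simp add: ball_unglued_edges at vG f j j' ne subgraphs_cycle1 corolla_cycle1 whole_cycle1)
  then show "has_image (graph_of (source (collapse u v a b)) (Sub_Verts {u, v} {a}))
      (target (collapse u v a b)) (emap (collapse u v a b) \<circ> base) (vmap (collapse u v a b))
      (Sub_Verts {0} {})"
    by (simp add: G_def f0_def f1_def collapse_def)
qed

lemma collapse_expand:
  assumes "u \<noteq> v" "a \<noteq> b"
  shows "graph_comp (collapse u v a b) (expand u v a b) = graph_id cycle1"
proof -
  have "emap (collapse u v a b) b = 0" "target (collapse u v a b) = cycle1"
    by (simp_all add: collapse_def)
  then show ?thesis
    using collapse_image[OF assms]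
    by (simp add: graph_comp_def graph_id_def expand_def fun_eq_iff restrict_def)
qed

section \<open>Maps to and from the exceptional loop\<close>

text \<open>
  Without vertices and legs, the image graph is the exceptional loop, and the only graph with such a
  subgraph is the exceptional loop itself.
\<close>

lemma exceptional_loop_of_vertexless_image:
  assumes "graphical_map G K f\<^sub>0 f\<^sub>1"
    and "\<forall>v\<in>verts G. verts (graph_of K (f\<^sub>1 v)) = {}" and "ins G = {}" "outs G = {}"
  shows "is_Exc_Loop K"
proof -
  obtain X where X: "X \<in> subgraphs K"
    "isomorphic_over (image_graph G K f\<^sub>0 f\<^sub>1) snd (image_edge_map f\<^sub>0) (graph_of K X) (\<lambda>w. w) base"
    using assms(1) by (auto simp: graphical_map_def has_image_def)
  have "(SIGMA v : verts G. verts (graph_of K (f\<^sub>1 v))) = {}" using assms(2) by auto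
  then have "is_Exc_Loop (image_graph G K f\<^sub>0 f\<^sub>1)"
    using assms(3,4) by (simp add: image_graph_def subst_def)
  then have "X = Sub_Loop"
    using isomorphic_over_transfer(2)[OF X(2)] by (simp add: exceptional_graph_of)
  then show ?thesis using X(1) by (simp add: Sub_Loop_in_subgraphs)
qed

lemma exceptional_loop_target:
  assumes "f \<in> graph_mors" "is_Exc_Loop (source f)"
  shows "is_Exc_Loop (target f)"
proof (rule exceptional_loop_of_vertexless_image)
  show "graphical_map (source f) (target f) (emap f) (vmap f)"
    using assms(1) by (simp add: graph_mors_iff)
qed (use assms(2) in \<open>cases "source f"; simp\<close>)+

text \<open>
  At \<open>v\<close> the two composites are the image under \<open>p\<close> of the corolla and the image under \<open>q\<close> of an edge.
  By \<open>subgraph_image_corolla\<close>, \<open>p\<close> cannot send the vertex to a subgraph with vertices.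
\<close>

lemma collapse_cocone_ends_in_loop:
  assumes "u \<noteq> v" "a \<noteq> b"
    and p: "p \<in> graph_mors" "source p = cycle1" and q: "q \<in> graph_mors" "source q = cycle1"
    and eq: "graph_comp p (collapse u v a b) = graph_comp q (collapse v u b a)"
  shows "is_Exc_Loop (target p)"
proof -
  have p': "graphical_map cycle1 (target p) (emap p) (vmap p)"
    using p by (simp add: graph_mors_iff)
  have "subgraph_image p (Sub_Verts {0} {}) = vmap (graph_comp p (collapse u v a b)) v"
    using assms(1) by (simp add: graph_comp_def collapse_def)
  also have "\<dots> = subgraph_image q (Sub_Edge 0)"
    unfolding eq by (simp add: graph_comp_def collapse_def)
  also have "\<dots> = Sub_Edge (emap q 0)"
    using q by (simp add: subgraph_image_edge)
  finally have im: "subgraph_image p (Sub_Verts {0} {}) = Sub_Edge (emap q 0)" .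
  have "vmap p 0 \<noteq> Sub_Verts S I" for S I
    using subgraph_image_corolla[OF p(1), of 0 S I] im p(2) by auto
  then have "verts (graph_of (target p) (vmap p 0)) = {}"
    by (cases "vmap p 0") auto
  then show ?thesis using p' by (intro exceptional_loop_of_vertexless_image[OF p']) simp_all
qed

section \<open>Strong pushouts\<close>

lemma wheeled_cat_simps:
  "Obj wheeled_cat = {G. wf_graph G}" "Arr wheeled_cat = graph_mors" "Dom wheeled_cat = source"
  "Cod wheeled_cat = target" "Idn wheeled_cat = graph_id" "Cmp wheeled_cat = graph_comp"
  by (simp_all add: wheeled_cat_def)

lemma wheeled_cat_without_loop_simps:
  "Arr wheeled_cat_without_loop =
     {f \<in> graph_mors. \<not> is_Exc_Loop (source f) \<and> \<not> is_Exc_Loop (target f)}"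
  "Dom wheeled_cat_without_loop = source"
  "Cod wheeled_cat_without_loop = target" "Idn wheeled_cat_without_loop = graph_id"
  "Cmp wheeled_cat_without_loop = graph_comp"
  by (simp_all add: wheeled_cat_without_loop_def full_subcategory_def wheeled_cat_def)

lemma source_target [simp]:
  "source (collapse u v a b) = cycle2 u v a b" "target (collapse u v a b) = cycle1"
  "source (expand u v a b) = cycle1" "target (expand u v a b) = cycle2 u v a b"
  "source (graph_comp g f) = source f" "target (graph_comp g f) = target g"
  "source (graph_id G) = G" "target (graph_id G) = G"
  by (simp_all add: collapse_def expand_def graph_comp_def graph_id_def)

lemma split_epi_collapse:
  assumes "\<Gamma> \<in> {wheeled_cat, wheeled_cat_without_loop}" "u \<noteq> v" "a \<noteq> b"
  shows "split_epi \<Gamma> (collapse u v a b)"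
proof -
  have "collapse u v a b \<in> Arr \<Gamma>"
    "expand u v a b \<in> hom \<Gamma> (Cod \<Gamma> (collapse u v a b)) (Dom \<Gamma> (collapse u v a b))"
    "Cmp \<Gamma> (collapse u v a b) (expand u v a b) = Idn \<Gamma> (Cod \<Gamma> (collapse u v a b))"
    using assms collapse_in_graph_mors[OF assms(2,3)] expand_in_graph_mors[OF assms(2,3)]
      collapse_expand[OF assms(2,3)]
    by (auto simp: hom_def wheeled_cat_simps wheeled_cat_without_loop_simps)
  then show ?thesis unfolding split_epi_def by blast
qed

lemma loop_to_loop:
  assumes "wf_graph G" "is_Exc_Loop G" "is_Exc_Loop K"
    "f\<^sub>0 \<in> edges G \<rightarrow> edges K"
  shows "graphical_map G K f\<^sub>0 f\<^sub>1"
proof -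
  obtain y z where [simp]: "G = Exc_Loop y" "K = Exc_Loop z"
    using assms by (cases G; cases K) auto
  show ?thesis
    using assms(4) has_image_loop[of f\<^sub>0 y z f\<^sub>1] by (auto simp: graphical_map_def)
qed

text \<open>
  The case of closure under composition on which the naturality of \<open>\<eta>\<close> below rests: a map between
  exceptional loops is just a function between one-point sets.
\<close>

lemma loop_comp:
  assumes "f \<in> graph_mors" "g \<in> graph_mors" "source g = target f" "is_Exc_Loop (source f)"
  shows "graph_comp g f \<in> graph_mors"
proof -
  have l: "is_Exc_Loop (target f)" "is_Exc_Loop (target g)"
    using exceptional_loop_target assms by metis+
  have e: "emap f \<in> edges (source f) \<rightarrow> edges (target f)" "emap g \<in> edges (target f) \<rightarrow> edges (target g)"
    "wf_graph (source f)" "wf_graph (target g)"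
    using assms(1-3) by (auto simp: graph_mors_iff graphical_map_def)
  have "emap (graph_comp g f) \<in> edges (source f) \<rightarrow> edges (target g)"
    using e by (auto simp: graph_comp_def)
  then have "graphical_map (source f) (target g) (emap (graph_comp g f)) (vmap (graph_comp g f))"
    using loop_to_loop e l assms(4) by metis
  then show ?thesis
    using e by (simp add: graph_mors_iff) (simp add: graph_comp_def)
qed

lemma loop_id:
  assumes "wf_graph G" "is_Exc_Loop G"
  shows "graph_id G \<in> graph_mors"
  using assms by (simp add: graph_mors_iff loop_to_loop) (simp add: graph_id_def loop_to_loop)

text \<open>
  The presheaf \<open>X\<close> has two elements at exceptional loops and one elsewhere; it is functorial because
  maps from exceptional loops end in exceptional loops. If neither leg of the span ended in an
  exceptional loop, no map from an exceptional loop would factor through \<open>p\<close> or \<open>q\<close>. The constant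
  transformation \<open>\<xi>\<close> and the transformation \<open>\<eta>\<close> with the other value on all maps from exceptional
  loops would then restrict equally along \<open>p\<close> and \<open>q\<close>, against uniqueness.
\<close>

lemma strong_pushout_reaches_loop:
  assumes po: "strong_pushout wheeled_cat f g p q" and P: "is_Exc_Loop (target p)"
  shows "is_Exc_Loop (target f) \<or> is_Exc_Loop (target g)"
proof (rule ccontr)
  assume "\<not> ?thesis"
  then have nl: "\<not> is_Exc_Loop (target f)" "\<not> is_Exc_Loop (target g)" by auto
  \<comment> \<open>The base point \<open>?z\<close> is the value that extensional functions take outside their domain. So
    \<open>\<xi>\<close> is constant on all maps, and its naturality holds without knowing that composites are maps.\<close>
  let ?C = wheeled_cat and ?z = "undefined :: (graph_mor + graph_mor) set"
  have p: "p \<in> graph_mors" "source p = target f" and q: "q \<in> graph_mors" "source q = target g"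
    and univ: "presheaf_pushout TYPE((graph_mor + graph_mor) set) ?C
       (yoneda ?C (source f)) (yoneda ?C (target f)) (yoneda ?C (target g)) (yoneda ?C (target p))
       (yoneda_map ?C f) (yoneda_map ?C g) (yoneda_map ?C p) (yoneda_map ?C q)"
    using po by (auto simp: strong_pushout_def wheeled_cat_simps)
  define X :: "((nat, nat) graph, graph_mor, (graph_mor + graph_mor) set) presheaf_data" where
    "X = \<lparr>sec = (\<lambda>r. if is_Exc_Loop r then {?z, - ?z} else {?z}),
          act = (\<lambda>h s. if is_Exc_Loop (source h) then s else ?z)\<rparr>"
  define \<xi> :: "(nat, nat) graph \<Rightarrow> graph_mor \<Rightarrow> (graph_mor + graph_mor) set"
    where "\<xi> = (\<lambda>r\<in>{G. wf_graph G}. \<lambda>x. ?z)"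
  define \<eta> :: "(nat, nat) graph \<Rightarrow> graph_mor \<Rightarrow> (graph_mor + graph_mor) set"
    where "\<eta> = (\<lambda>r\<in>{G. wf_graph G}. \<lambda>x. if is_Exc_Loop r \<and> x \<in> hom ?C r (target p) then - ?z else ?z)"
  have X: "presheaf ?C X"
    using exceptional_loop_target by (auto simp: presheaf_def X_def hom_def wheeled_cat_simps)
  have wf: "wf_graph (source h)" "wf_graph (target h)" if "h \<in> graph_mors" for h
    using that by (simp_all add: graph_mors_iff)
  have const: "nat_trans ?C (yoneda ?C t) X \<xi>" for t
    unfolding nat_trans_def
    by (auto simp: PiE_iff extensional_def X_def \<xi>_def yoneda_def hom_def wheeled_cat_simps wf)
  have nat: "nat_trans ?C (yoneda ?C (target p)) X \<eta>"
    unfolding nat_trans_def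
  proof (intro conjI allI ballI)
    show "\<eta> \<in> (\<Pi>\<^sub>E r\<in>Obj ?C. sec (yoneda ?C (target p)) r \<rightarrow>\<^sub>E sec X r)"
      by (auto simp: PiE_iff extensional_def X_def \<eta>_def yoneda_def wheeled_cat_simps)
  next
    fix r s h x assume h: "h \<in> hom ?C r s" and "x \<in> sec (yoneda ?C (target p)) s"
    then have x: "x \<in> hom ?C s (target p)" by (simp add: yoneda_def)
    have "graph_comp x h \<in> hom ?C r (target p)" "is_Exc_Loop s" if "is_Exc_Loop r"
      using h x that loop_comp[of h x] exceptional_loop_target[of h] by (auto simp: hom_def wheeled_cat_simps)
    then show "\<eta> r (act (yoneda ?C (target p)) h x) = act X h (\<eta> s x)"
      using h x by (auto simp: yoneda_def X_def \<eta>_def wheeled_cat_simps wf hom_def)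
  qed
  have "\<exists>!\<theta>. nat_trans ?C (yoneda ?C (target p)) X \<theta> \<and>
     (\<forall>r\<in>Obj ?C. \<forall>x\<in>sec (yoneda ?C (target f)) r. \<theta> r (yoneda_map ?C p r x) = \<xi> r x) \<and>
     (\<forall>r\<in>Obj ?C. \<forall>x\<in>sec (yoneda ?C (target g)) r. \<theta> r (yoneda_map ?C q r x) = \<xi> r x)"
  proof (rule univ[unfolded presheaf_pushout_def, THEN conjunct2, THEN spec[of _ X],
        THEN spec[of _ \<xi>], THEN spec[of _ \<xi>], THEN mp], intro conjI ballI)
    fix r x assume "r \<in> Obj ?C"
    then show "\<xi> r (yoneda_map ?C f r x) = \<xi> r (yoneda_map ?C g r x)"
      by (simp add: \<xi>_def wheeled_cat_simps)
  qed (use X const in simp_all)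
  moreover have "\<eta> r (yoneda_map ?C h r x) = \<xi> r x"
    if "r \<in> Obj ?C" "x \<in> sec (yoneda ?C t) r" "\<not> is_Exc_Loop t" for r x h t
  proof -
    have "\<not> is_Exc_Loop r"
      using that exceptional_loop_target[of x] by (auto simp: yoneda_def hom_def wheeled_cat_simps)
    then show ?thesis using that(1) by (simp add: \<eta>_def \<xi>_def wheeled_cat_simps)
  qed
  moreover have "\<xi> r (yoneda_map ?C h r x) = \<xi> r x" if "r \<in> Obj ?C" for r x h
    using that by (simp add: \<xi>_def wheeled_cat_simps)
  ultimately have "\<eta> = \<xi>" using const[of "target p"] nat nl by blast
  moreover have "\<eta> (target p) (graph_id (target p)) = - ?z" "\<xi> (target p) (graph_id (target p)) = ?z"
    using wf(2)[OF p(1)] P loop_id[of "target p"] by (auto simp: \<eta>_def \<xi>_def hom_def wheeled_cat_simps)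
  ultimately have "- ?z = ?z" by simp
  then show False by blast
qed

theorem theorem4p11:
  fixes \<Gamma> :: "((nat, nat) graph, graph_mor) category"
  assumes "\<Gamma> \<in> {wheeled_cat, wheeled_cat_without_loop}"
  shows "\<not> (\<exists>deg :: (nat, nat) graph \<Rightarrow> nat. ez_category \<Gamma> deg)"
proof
  assume "\<exists>deg :: (nat, nat) graph \<Rightarrow> nat. ez_category \<Gamma> deg"
  then obtain deg :: "(nat, nat) graph \<Rightarrow> nat" where ez: "ez_category \<Gamma> deg" by blast
  define f g where "f = collapse 0 1 0 1" and "g = collapse 1 0 1 0"
  have \<Gamma>: "Dom \<Gamma> = source" "Cod \<Gamma> = target" "Cmp \<Gamma> = graph_comp" "Arr \<Gamma> \<subseteq> graph_mors"
    using assms by (auto simp: wheeled_cat_simps wheeled_cat_without_loop_simps)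
  have "Dom \<Gamma> f = Dom \<Gamma> g"
    using cycle2_sym[of 0 1 0 1] by (simp add: \<Gamma> f_def g_def)
  moreover have "split_epi \<Gamma> f" "split_epi \<Gamma> g"
    unfolding f_def g_def by (rule split_epi_collapse[OF assms]; simp)+
  ultimately obtain p q where po: "strong_pushout \<Gamma> f g p q"
    using ez unfolding ez_category_def by blast
  then have "is_Exc_Loop (target p)"
    using \<Gamma> by (intro collapse_cocone_ends_in_loop[of 0 1 0 1 p q])
      (auto simp: strong_pushout_def f_def g_def)
  show False
  proof (cases "\<Gamma> = wheeled_cat")
    case True
    then show ?thesis
      using strong_pushout_reaches_loop[of f g p q] po \<open>is_Exc_Loop (target p)\<close>
      by (simp add: f_def g_def)
  next
    case False
    then have "\<not> is_Exc_Loop (target p)"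
      using assms po by (auto simp: strong_pushout_def wheeled_cat_without_loop_simps)
    then show ?thesis using \<open>is_Exc_Loop (target p)\<close> by simp
  qed
qed

end
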